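(* Let $f,g:\mathbb{C}\to\mathbb{C}$ be non-constant, non-injective entire maps and let $z_0\in\mathbb{C}$ be a common periodic point of $f$ and $g$ which is superattracting for $g$. If the semigroup $\langle f,g\rangle$ generated by $f$ and $g$ under composition contains neither free non-cyclic nor free abelian non-cyclic subsemigroups, then $f$ and $g$ have the same set of preperiodic points.
   Context: A point is preperiodic for a map if its forward orbit is finite. A periodic point $z_0$ of period $l$ of $g$ is superattracting if $(g^l)'(z_0)=0$. "Free non-cyclic" means free on at least two generators; "free abelian non-cyclic" means a free abelian semigroup of rank at least two. *)

theory Defs
  imports "HOL-Complex_Analysis.Complex_Analysis" "HOL-Library.Multiset"
begin

definition preperiodic_points :: "('a \<Rightarrow> 'a) \<Rightarrow> 'a set" where
  "preperiodic_points f = {z. finite (range (\<lambda>n. (f ^^ n) z))}"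

text \<open>A period is any positive return time, not necessarily the least one.\<close>

definition has_period :: "('a \<Rightarrow> 'a) \<Rightarrow> nat \<Rightarrow> 'a \<Rightarrow> bool" where
  "has_period f l z \<longleftrightarrow> l > 0 \<and> (f ^^ l) z = z"

definition periodic_point :: "('a \<Rightarrow> 'a) \<Rightarrow> 'a \<Rightarrow> bool" where
  "periodic_point f z \<longleftrightarrow> (\<exists>l. has_period f l z)"

text \<open>By the chain rule, the choice of the period does not matter for holomorphic maps: the
  derivative at a multiple of the least period is a power of the derivative at the least one.\<close>

definition superattracting :: "(complex \<Rightarrow> complex) \<Rightarrow> complex \<Rightarrow> bool" where
  "superattracting g z \<longleftrightarrow> (\<exists>l. has_period g l z \<and> deriv (g ^^ l) z = 0)"

inductive_set generated_semigroup :: "('a \<Rightarrow> 'a) set \<Rightarrow> ('a \<Rightarrow> 'a) set"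
  for B :: "('a \<Rightarrow> 'a) set" where
  generator: "b \<in> B \<Longrightarrow> b \<in> generated_semigroup B"
| comp: "s \<in> generated_semigroup B \<Longrightarrow> t \<in> generated_semigroup B \<Longrightarrow> s \<circ> t \<in> generated_semigroup B"

definition word_map :: "('a \<Rightarrow> 'a) list \<Rightarrow> 'a \<Rightarrow> 'a" where
  "word_map w = foldr (\<circ>) w id"

text \<open>The free semigroup on a set consists of the nonempty words over that set, and the free
  abelian semigroup of the nonempty finite multisets. In the abelian case the implication from
  right to left says that the elements of the basis commute.\<close>

definition free_basis :: "('a \<Rightarrow> 'a) set \<Rightarrow> bool" where
  "free_basis B \<longleftrightarrow> inj_on word_map {w \<in> lists B. w \<noteq> []}"

definition free_abelian_basis :: "('a \<Rightarrow> 'a) set \<Rightarrow> bool" where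
  "free_abelian_basis B \<longleftrightarrow>
     (\<forall>v \<in> lists B. \<forall>w \<in> lists B. v \<noteq> [] \<longrightarrow> w \<noteq> [] \<longrightarrow> (word_map v = word_map w \<longleftrightarrow> mset v = mset w))"

definition free_noncyclic_semigroup :: "('a \<Rightarrow> 'a) set \<Rightarrow> bool" where
  "free_noncyclic_semigroup T \<longleftrightarrow>
     (\<exists>B. T = generated_semigroup B \<and> free_basis B \<and> (\<exists>a \<in> B. \<exists>b \<in> B. a \<noteq> b))"

definition free_abelian_noncyclic_semigroup :: "('a \<Rightarrow> 'a) set \<Rightarrow> bool" where
  "free_abelian_noncyclic_semigroup T \<longleftrightarrow>
     (\<exists>B. T = generated_semigroup B \<and> free_abelian_basis B \<and> (\<exists>a \<in> B. \<exists>b \<in> B. a \<noteq> b))"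

end

theory Submission
  imports Defs
begin

text \<open>
Some iterates of \<open>f\<close> and \<open>g\<close> fix \<open>z\<^sub>0\<close>. Passing to them keeps the sets of preperiodic points and
shrinks the semigroup, so let \<open>f\<close> and \<open>g\<close> fix \<open>z\<^sub>0\<close>, with \<open>g\<close> critical there. Every nonconstant
entire \<open>h\<close> fixing \<open>z\<^sub>0\<close> has a leading term \<open>c (z - z\<^sub>0)^N\<close>, and leading terms compose like monomials.
The idea is that the absence of free subsemigroups makes the semigroup as small as a
semigroup of monomials whose coefficients are roots of unity.

Take two elements \<open>h\<close> and \<open>k\<close> of the semigroup with the same order \<open>N \<ge> 2\<close>. If the quotient of their
leading coefficients is not a root of unity, the leading coefficient of a word in \<open>h\<close> and \<open>k\<close> is a power
of that quotient whose exponent has the word as its base \<open>N\<close> expansion, so that words can be read off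
(\<open>free_basis_independent_leading_coefficients\<close>). If the leading coefficients agree but
\<open>h \<noteq> k\<close>, the letter applied first decides: relative to the value, a difference of relative order
\<open>p\<close> in the first letter keeps its relative order, while a difference in a later letter is pulled
back along a map of order at least \<open>2\<close> and has relative order at least \<open>2 p\<close>. Again the words are distinct
(\<open>free_basis_equal_leading_coefficients\<close>). So, with no free subsemigroup, elements of the same order
have leading coefficients that differ by a root of unity, and equal leading coefficients force
equal maps.

This excludes order \<open>1\<close> for \<open>f\<close>: some \<open>f^j \<circ> g\<close> would have the same leading term as \<open>g\<close>, whence \<open>f^j\<close> would be
the identity and \<open>f\<close> injective (\<open>order_at_least_two\<close>). For order at least \<open>2\<close>, comparing \<open>f \<circ> g\<close>
with \<open>g \<circ> f\<close> shows that, in a coordinate scaled so that \<open>g\<close> is monic, the leading coefficient of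
\<open>f\<close>, hence that of every element, is a \<open>K\<close>-th root of unity for one \<open>K\<close>. The semigroup therefore has
at most \<open>K\<close> elements of any given order (\<open>no_free_order_class_bounded\<close>), and the rest is counting.
Let \<open>d\<close> and \<open>m\<close> be the orders of \<open>f\<close> and \<open>g\<close>.

If no positive powers of \<open>d\<close> and \<open>m\<close> agree, two of the maps \<open>g^i \<circ> f \<circ> g^k\<close> with \<open>i + k\<close> fixed coincide. After
cancellation on the right this says that some \<open>g^i \<circ> f\<close> commutes with some \<open>g^j\<close>, \<open>j > 0\<close>. Their
orders are multiplicatively independent, so they generate a free abelian semigroup of rank two,
a contradiction (\<open>independent_orders_free_abelian\<close>). Otherwise iterates \<open>P\<close> of \<open>f\<close> and \<open>Q\<close> of \<open>g\<close> have the
same order, two of the maps \<open>P^i \<circ> Q^k\<close> with \<open>i + k\<close> fixed coincide, and \<open>P^(t + s) = P^t \<circ> Q^s\<close> for some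
\<open>s > 0\<close> (\<open>same_order_relation\<close>). Thus \<open>P^t\<close> semiconjugates \<open>Q^s\<close> to \<open>P^s\<close> and maps finite
orbits to finite orbits, which gives one inclusion (\<open>preperiodic_points_subset\<close>). The other one follows by
exchanging \<open>P\<close> and \<open>Q\<close>.
\<close>

section \<open>Nonconstant entire maps fixing a point\<close>

definition fixing_entire_maps :: "complex \<Rightarrow> (complex \<Rightarrow> complex) set" where
  "fixing_entire_maps z\<^sub>0 =
     {h. h holomorphic_on UNIV \<and> \<not> h constant_on UNIV \<and> h z\<^sub>0 = z\<^sub>0}"

text \<open>The range of \<open>h\<close> is open, so the identity theorem extends the agreement of \<open>a\<close> and \<open>b\<close> from there to the
whole plane. Cancellation on the left fails in general, which is why all relations below are compared
from the right.\<close>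

lemma entire_right_cancel:
  fixes a b h :: "complex \<Rightarrow> complex"
  assumes "a holomorphic_on UNIV" "b holomorphic_on UNIV"
    and "h holomorphic_on UNIV" "\<not> h constant_on UNIV"
    and "a \<circ> h = b \<circ> h"
  shows "a = b"
proof
  fix z
  have "open (range h)"
    using open_mapping_thm[of h UNIV UNIV] assms(3,4) connected_UNIV by simp
  moreover have "a w = b w" if "w \<in> range h" for w
    using that assms(5) by (metis comp_apply imageE)
  ultimately show "a z = b z"
    using analytic_continuation_open[of "range h" UNIV a b z] assms(1,2) by auto
qed

lemma fixing_entire_maps_comp:
  fixes h k :: "complex \<Rightarrow> complex"
  assumes "h \<in> fixing_entire_maps z\<^sub>0" "k \<in> fixing_entire_maps z\<^sub>0"
  shows "h \<circ> k \<in> fixing_entire_maps z\<^sub>0"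
proof -
  have "\<not> (h \<circ> k) constant_on UNIV"
  proof
    assume "(h \<circ> k) constant_on UNIV"
    then obtain c where "h \<circ> k = (\<lambda>_. c) \<circ> k"
      by (auto simp: constant_on_def fun_eq_iff)
    then have "h = (\<lambda>_. c)"
      using assms by (intro entire_right_cancel[of h _ k]) (auto simp: fixing_entire_maps_def)
    then show False
      using assms by (auto simp: fixing_entire_maps_def constant_on_def)
  qed
  then show ?thesis
    using assms by (auto simp: fixing_entire_maps_def intro!: holomorphic_on_compose
        intro: holomorphic_on_subset)
qed

lemma generated_semigroup_subset_fixing:
  assumes "A \<subseteq> fixing_entire_maps z\<^sub>0"
  shows "generated_semigroup A \<subseteq> fixing_entire_maps z\<^sub>0"
proof
  fix h assume "h \<in> generated_semigroup A"
  then show "h \<in> fixing_entire_maps z\<^sub>0"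
    by induction (use assms fixing_entire_maps_comp in blast)+
qed

lemma funpow_in_generated_semigroup:
  fixes h :: "'a \<Rightarrow> 'a"
  assumes "h \<in> generated_semigroup A" "n > 0"
  shows "h ^^ n \<in> generated_semigroup A"
  using assms(2)
proof (induction n rule: nat_induct_non_zero)
  case 1
  then show ?case using assms(1) by simp
next
  case (Suc n)
  then show ?case using assms(1) generated_semigroup.comp by (metis funpow.simps(2))
qed

lemma generated_semigroup_mono:
  assumes "A \<subseteq> generated_semigroup B"
  shows "generated_semigroup A \<subseteq> generated_semigroup B"
proof
  fix h assume "h \<in> generated_semigroup A"
  then show "h \<in> generated_semigroup B"
    by induction (use assms generated_semigroup.comp in blast)+
qed

lemma fixing_right_cancel:
  assumes "a \<circ> h = b \<circ> h"
    and "a \<in> fixing_entire_maps z\<^sub>0" "b \<in> fixing_entire_maps z\<^sub>0" "h \<in> fixing_entire_maps z\<^sub>0"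
  shows "a = b"
  using assms by (intro entire_right_cancel[of a b h]) (simp_all add: fixing_entire_maps_def)

section \<open>Leading terms\<close>

text \<open>A limit rather than a Taylor coefficient: limits compose directly, and only the behaviour near \<open>z\<^sub>0\<close>
matters.\<close>

definition leading_term :: "complex \<Rightarrow> (complex \<Rightarrow> complex) \<Rightarrow> nat \<Rightarrow> complex \<Rightarrow> bool" where
  "leading_term z\<^sub>0 h N c \<longleftrightarrow>
     c \<noteq> 0 \<and> ((\<lambda>z. (h z - z\<^sub>0) / (z - z\<^sub>0) ^ N) \<longlongrightarrow> c) (at z\<^sub>0)"

lemma tendsto_power_shift:
  fixes z\<^sub>0 :: complex
  assumes "n > 0"
  shows "((\<lambda>z. (z - z\<^sub>0) ^ n) \<longlongrightarrow> 0) (at z\<^sub>0)"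
proof -
  have "((\<lambda>z. (z - z\<^sub>0) ^ n) \<longlongrightarrow> (z\<^sub>0 - z\<^sub>0) ^ n) (at z\<^sub>0)"
    by (intro tendsto_intros)
  then show ?thesis using assms by (simp add: power_0_left)
qed

lemma tendsto_quotient_lower_order:
  fixes z\<^sub>0 :: complex
  assumes "((\<lambda>z. u z / (z - z\<^sub>0) ^ M) \<longlongrightarrow> e) (at z\<^sub>0)" "N < M"
  shows "((\<lambda>z. u z / (z - z\<^sub>0) ^ N) \<longlongrightarrow> 0) (at z\<^sub>0)"
proof -
  have "((\<lambda>z. u z / (z - z\<^sub>0) ^ M * (z - z\<^sub>0) ^ (M - N)) \<longlongrightarrow> e * 0) (at z\<^sub>0)"
    using assms by (intro tendsto_mult tendsto_power_shift) auto
  moreover have "\<forall>\<^sub>F z in at z\<^sub>0. u z / (z - z\<^sub>0) ^ M * (z - z\<^sub>0) ^ (M - N) = u z / (z - z\<^sub>0) ^ N"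
    using assms(2) by (auto simp: eventually_at_filter divide_simps simp flip: power_add)
  ultimately show ?thesis
    by (simp add: tendsto_cong)
qed

lemma leading_term_unique:
  assumes "leading_term z\<^sub>0 h N c" "leading_term z\<^sub>0 h M e"
  shows "N = M" "c = e"
proof -
  have le: "\<not> i < j" if "leading_term z\<^sub>0 h i a" "leading_term z\<^sub>0 h j b" for i j a b
  proof
    assume "i < j"
    then have "((\<lambda>z. (h z - z\<^sub>0) / (z - z\<^sub>0) ^ i) \<longlongrightarrow> 0) (at z\<^sub>0)"
      using that(2) tendsto_quotient_lower_order[of "\<lambda>z. h z - z\<^sub>0" z\<^sub>0 j b i]
      unfolding leading_term_def by blast
    then show False
      using that(1) tendsto_unique[OF trivial_limit_at] unfolding leading_term_def by blast
  qed
  show "N = M"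
    using le[OF assms] le[OF assms(2,1)] by simp
  with assms show "c = e"
    using tendsto_unique[OF trivial_limit_at] unfolding leading_term_def by blast
qed

lemma leading_term_tendsto:
  assumes "leading_term z\<^sub>0 h N c" "N > 0"
  shows "filterlim h (at z\<^sub>0) (at z\<^sub>0)"
proof -
  have lim: "((\<lambda>z. (h z - z\<^sub>0) / (z - z\<^sub>0) ^ N) \<longlongrightarrow> c) (at z\<^sub>0)" and "c \<noteq> 0"
    using assms(1) by (auto simp: leading_term_def)
  have "((\<lambda>z. (h z - z\<^sub>0) / (z - z\<^sub>0) ^ 0) \<longlongrightarrow> 0) (at z\<^sub>0)"
    using tendsto_quotient_lower_order[OF lim] assms(2) by blast
  then have "(h \<longlongrightarrow> z\<^sub>0) (at z\<^sub>0)"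
    by (simp add: LIM_zero_iff)
  moreover have "\<forall>\<^sub>F z in at z\<^sub>0. h z \<noteq> z\<^sub>0"
    using tendsto_imp_eventually_ne[OF lim \<open>c \<noteq> 0\<close>] by eventually_elim auto
  ultimately show ?thesis
    by (auto simp: filterlim_at)
qed

lemma leading_term_id: "leading_term z\<^sub>0 id 1 1"
proof -
  have "\<forall>\<^sub>F z in at z\<^sub>0. (id z - z\<^sub>0) / (z - z\<^sub>0) ^ 1 = 1"
    by (auto simp: eventually_at_filter)
  then show ?thesis
    unfolding leading_term_def by (auto intro: tendsto_eventually)
qed

text \<open>Monomials compose in the same way: \<open>c (e z^M)^N = c e^N z^(M N)\<close>.\<close>

lemma leading_term_comp:
  fixes h k :: "complex \<Rightarrow> complex"
  assumes h: "leading_term z\<^sub>0 h N c" and k: "leading_term z\<^sub>0 k M e" "M > 0"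
  shows "leading_term z\<^sub>0 (h \<circ> k) (M * N) (c * e ^ N)"
proof -
  note k_lim = leading_term_tendsto[OF k]
  have "((\<lambda>z. (h (k z) - z\<^sub>0) / (k z - z\<^sub>0) ^ N) \<longlongrightarrow> c) (at z\<^sub>0)"
    using h filterlim_compose[OF _ k_lim] unfolding leading_term_def by blast
  moreover have "((\<lambda>z. ((k z - z\<^sub>0) / (z - z\<^sub>0) ^ M) ^ N) \<longlongrightarrow> e ^ N) (at z\<^sub>0)"
    using k(1) by (intro tendsto_power) (simp add: leading_term_def)
  ultimately have
    "((\<lambda>z. (h (k z) - z\<^sub>0) / (k z - z\<^sub>0) ^ N * ((k z - z\<^sub>0) / (z - z\<^sub>0) ^ M) ^ N)
        \<longlongrightarrow> c * e ^ N) (at z\<^sub>0)"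
    by (rule tendsto_mult)
  moreover have "\<forall>\<^sub>F z in at z\<^sub>0.
      (h (k z) - z\<^sub>0) / (k z - z\<^sub>0) ^ N * ((k z - z\<^sub>0) / (z - z\<^sub>0) ^ M) ^ N
        = ((h \<circ> k) z - z\<^sub>0) / (z - z\<^sub>0) ^ (M * N)"
  proof -
    have "\<forall>\<^sub>F z in at z\<^sub>0. k z \<noteq> z\<^sub>0"
      using k_lim by (simp add: filterlim_at)
    then show ?thesis
      by eventually_elim (simp add: power_divide power_mult)
  qed
  ultimately show ?thesis
    using h k by (simp add: leading_term_def tendsto_cong)
qed

lemma fixing_entire_factorization:
  assumes "h \<in> fixing_entire_maps z\<^sub>0"
  obtains N c k r where "N > 0" "leading_term z\<^sub>0 h N c" "r > 0" "k holomorphic_on ball z\<^sub>0 r"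
    "\<And>w. w \<in> ball z\<^sub>0 r \<Longrightarrow> h w - z\<^sub>0 = (w - z\<^sub>0) ^ N * k w" "k z\<^sub>0 = c"
proof -
  have hol: "(\<lambda>z. h z - z\<^sub>0) holomorphic_on UNIV" and zero: "h z\<^sub>0 - z\<^sub>0 = 0"
    using assms by (auto simp: fixing_entire_maps_def intro!: holomorphic_intros)
  have nonconst: "\<not> (\<lambda>z. h z - z\<^sub>0) constant_on UNIV"
  proof
    assume "(\<lambda>z. h z - z\<^sub>0) constant_on UNIV"
    then obtain y where "\<And>z. h z - z\<^sub>0 = y"
      by (auto simp: constant_on_def)
    then have "h z = y + z\<^sub>0" for z
      by (metis diff_add_cancel)
    then show False
      using assms by (auto simp: fixing_entire_maps_def constant_on_def)
  qed
  obtain k r N where k: "0 < N" "0 < r" "ball z\<^sub>0 r \<subseteq> UNIV" "k holomorphic_on ball z\<^sub>0 r"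
    "\<And>w. w \<in> ball z\<^sub>0 r \<Longrightarrow> h w - z\<^sub>0 = (w - z\<^sub>0) ^ N * k w"
    "\<And>w. w \<in> ball z\<^sub>0 r \<Longrightarrow> k w \<noteq> 0"
    by (rule holomorphic_factor_zero_nonconstant
        [OF hol open_UNIV connected_UNIV UNIV_I zero nonconst]) (rule that)
  have "isCont k z\<^sub>0"
    using k(2,4) holomorphic_on_imp_continuous_on[of k "ball z\<^sub>0 r"]
    by (simp add: continuous_on_eq_continuous_at)
  then have "(k \<longlongrightarrow> k z\<^sub>0) (at z\<^sub>0)"
    by (simp add: isCont_def)
  moreover have "\<forall>\<^sub>F z in at z\<^sub>0. k z = (h z - z\<^sub>0) / (z - z\<^sub>0) ^ N"
  proof -
    have "\<forall>\<^sub>F z in at z\<^sub>0. z \<in> ball z\<^sub>0 r"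
      using k(2) eventually_at_in_open'[of "ball z\<^sub>0 r" z\<^sub>0] by simp
    moreover have "\<forall>\<^sub>F z in at z\<^sub>0. z \<noteq> z\<^sub>0"
      by (rule eventually_neq_at_within)
    ultimately show ?thesis
      by eventually_elim (simp add: k(5))
  qed
  ultimately have "leading_term z\<^sub>0 h N (k z\<^sub>0)"
    using k(2,6) by (auto simp: leading_term_def tendsto_cong)
  then show thesis
    using that[of N "k z\<^sub>0" r k] k by auto
qed

lemma leading_term_exists:
  assumes "h \<in> fixing_entire_maps z\<^sub>0"
  obtains N c where "N > 0" "leading_term z\<^sub>0 h N c"
  using fixing_entire_factorization[OF assms] by metis

lemma superattracting_order:
  assumes "h \<in> fixing_entire_maps z\<^sub>0" "leading_term z\<^sub>0 h N c" "deriv h z\<^sub>0 = 0"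
  shows "N \<ge> 2"
proof -
  have "N > 0"
    using leading_term_exists[OF assms(1)] leading_term_unique(1)[OF assms(2)] by metis
  moreover have "N \<noteq> 1"
  proof
    assume "N = 1"
    have "(h has_field_derivative 0) (at z\<^sub>0)"
      using assms(1,3) holomorphic_derivI[of h UNIV z\<^sub>0] by (auto simp: fixing_entire_maps_def)
    then have "((\<lambda>z. (h z - z\<^sub>0) / (z - z\<^sub>0) ^ N) \<longlongrightarrow> 0) (at z\<^sub>0)"
      using assms(1) \<open>N = 1\<close>
      by (simp add: has_field_derivative_iff fixing_entire_maps_def)
    then show False
      using assms(2) tendsto_unique[OF trivial_limit_at] unfolding leading_term_def by blast
  qed
  ultimately show ?thesis by simp
qed

section \<open>Propagation of a difference through composition\<close>

text \<open>The order \<open>N + p\<close> of \<open>h - k\<close> exceeds \<open>N\<close> because the leading terms cancel; \<open>p\<close> is the order of the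
difference relative to the maps themselves.\<close>

lemma difference_order:
  assumes "h \<in> fixing_entire_maps z\<^sub>0" "k \<in> fixing_entire_maps z\<^sub>0"
    and "leading_term z\<^sub>0 h N c" "leading_term z\<^sub>0 k N c" and "h \<noteq> k"
  obtains p a where "p > 0" "a \<noteq> 0" "((\<lambda>z. (h z - k z) / (z - z\<^sub>0) ^ (N + p)) \<longlongrightarrow> a) (at z\<^sub>0)"
proof -
  \<comment> \<open>The shift by \<open>z\<^sub>0\<close> makes the difference a map that fixes \<open>z\<^sub>0\<close>.\<close>
  define D where "D = (\<lambda>z. h z - k z + z\<^sub>0)"
  have "\<not> D constant_on UNIV"
  proof
    assume "D constant_on UNIV"
    then have "D z = D z\<^sub>0" for z
      by (auto simp: constant_on_def)
    then have "h z = k z" for z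
      using assms(1,2) by (simp add: D_def fixing_entire_maps_def)
    then show False using \<open>h \<noteq> k\<close> by blast
  qed
  then have "D \<in> fixing_entire_maps z\<^sub>0"
    using assms(1,2) unfolding fixing_entire_maps_def D_def by (auto intro!: holomorphic_intros)
  then obtain n a where "leading_term z\<^sub>0 D n a"
    using leading_term_exists by blast
  then have a: "a \<noteq> 0" "((\<lambda>z. (h z - k z) / (z - z\<^sub>0) ^ n) \<longlongrightarrow> a) (at z\<^sub>0)"
    by (auto simp: leading_term_def D_def)
  have "((\<lambda>z. (h z - z\<^sub>0) / (z - z\<^sub>0) ^ N - (k z - z\<^sub>0) / (z - z\<^sub>0) ^ N) \<longlongrightarrow> c - c) (at z\<^sub>0)"
    using assms(3,4) by (intro tendsto_diff) (auto simp: leading_term_def)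
  then have zero: "((\<lambda>z. (h z - k z) / (z - z\<^sub>0) ^ N) \<longlongrightarrow> 0) (at z\<^sub>0)"
    by (simp flip: diff_divide_distrib)
  have "\<not> n \<le> N"
  proof
    assume "n \<le> N"
    then have "((\<lambda>z. (h z - k z) / (z - z\<^sub>0) ^ n) \<longlongrightarrow> 0) (at z\<^sub>0)"
      using zero tendsto_quotient_lower_order[OF zero, of n] by (cases "n = N") auto
    then show False
      using a tendsto_unique[OF trivial_limit_at] by blast
  qed
  then show thesis
    using that[of "n - N" a] a by simp
qed

lemma holomorphic_lipschitz_near:
  assumes "k holomorphic_on ball z\<^sub>0 r" "r > 0"
  obtains L s where "s > 0" "s \<le> r"
    "\<And>x y. x \<in> ball z\<^sub>0 s \<Longrightarrow> y \<in> ball z\<^sub>0 s \<Longrightarrow> norm (k x - k y) \<le> L * norm (x - y)"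
proof -
  have sub: "cball z\<^sub>0 (r/2) \<subseteq> ball z\<^sub>0 r"
    using assms(2) by auto
  have "continuous_on (cball z\<^sub>0 (r/2)) (deriv k)"
    using assms(1) sub
    by (meson holomorphic_deriv holomorphic_on_imp_continuous_on holomorphic_on_subset open_ball)
  then have "bounded (deriv k ` cball z\<^sub>0 (r/2))"
    by (intro compact_imp_bounded compact_continuous_image) auto
  then obtain L where L: "\<forall>z\<in>cball z\<^sub>0 (r/2). norm (deriv k z) \<le> L"
    unfolding bounded_iff by blast
  have "norm (k x - k y) \<le> L * norm (x - y)"
    if "x \<in> ball z\<^sub>0 (r/2)" "y \<in> ball z\<^sub>0 (r/2)" for x y
  proof (rule field_differentiable_bound[of "ball z\<^sub>0 (r/2)" k "deriv k"])
    fix z assume "z \<in> ball z\<^sub>0 (r/2)"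
    then have "z \<in> cball z\<^sub>0 (r/2)" by simp
    moreover from this have "z \<in> ball z\<^sub>0 r" using sub by blast
    ultimately show "(k has_field_derivative deriv k z) (at z within ball z\<^sub>0 (r/2))" "norm (deriv k z) \<le> L"
      using holomorphic_derivI[OF assms(1)] L by auto
  qed (use that in auto)
  then show thesis
    using that[of "r/2" L] assms(2) by auto
qed

text \<open>Since \<open>X\<close> and \<open>Y\<close> have the same leading term, \<open>h (X z) - h (Y z)\<close> behaves like
\<open>h' (X z) (X z - Y z)\<close>, where \<open>h' w\<close> behaves like \<open>N c (w - z\<^sub>0)^(N - 1)\<close>. Both the values and the differences gain
the factor \<open>(z - z\<^sub>0)^(M (N - 1))\<close>, so the relative order \<open>p\<close> is preserved.\<close>

lemma difference_comp_left:
  assumes h: "h \<in> fixing_entire_maps z\<^sub>0" "leading_term z\<^sub>0 h N c"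
    and X: "leading_term z\<^sub>0 X M C" and Y: "leading_term z\<^sub>0 Y M C" and "M > 0"
    and diff: "((\<lambda>z. (X z - Y z) / (z - z\<^sub>0) ^ (M + p)) \<longlongrightarrow> A) (at z\<^sub>0)"
  shows "((\<lambda>z. (h (X z) - h (Y z)) / (z - z\<^sub>0) ^ (M * N + p)) \<longlongrightarrow> of_nat N * c * C ^ (N - 1) * A)
           (at z\<^sub>0)"
proof -
  obtain N' c' k r where fact: "N' > 0" "leading_term z\<^sub>0 h N' c'" "r > 0"
    "k holomorphic_on ball z\<^sub>0 r"
    "\<And>w. w \<in> ball z\<^sub>0 r \<Longrightarrow> h w - z\<^sub>0 = (w - z\<^sub>0) ^ N' * k w" "k z\<^sub>0 = c'"
    using fixing_entire_factorization[OF h(1)] by metis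
  have N': "N' = N" "c' = c"
    using leading_term_unique[OF fact(2) h(2)] by auto
  obtain L s where L: "s > 0" "s \<le> r"
    "\<And>x y. x \<in> ball z\<^sub>0 s \<Longrightarrow> y \<in> ball z\<^sub>0 s \<Longrightarrow> norm (k x - k y) \<le> L * norm (x - y)"
    using holomorphic_lipschitz_near[OF fact(4,3)] by metis
  have lim: "(X \<longlongrightarrow> z\<^sub>0) (at z\<^sub>0)" "(Y \<longlongrightarrow> z\<^sub>0) (at z\<^sub>0)"
    using leading_term_tendsto[OF X \<open>M > 0\<close>] leading_term_tendsto[OF Y \<open>M > 0\<close>]
    by (auto simp: filterlim_at)
  have ball: "\<forall>\<^sub>F z in at z\<^sub>0. X z \<in> ball z\<^sub>0 s" "\<forall>\<^sub>F z in at z\<^sub>0. Y z \<in> ball z\<^sub>0 s"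
    using topological_tendstoD[OF lim(1) open_ball, of z\<^sub>0 s]
      topological_tendstoD[OF lim(2) open_ball, of z\<^sub>0 s] L(1) by simp_all
  have ne: "\<forall>\<^sub>F z in at z\<^sub>0. z \<noteq> z\<^sub>0"
    by (simp add: eventually_neq_at_within)
  define u where "u = (\<lambda>z. (X z - z\<^sub>0) / (z - z\<^sub>0) ^ M)"
  define v where "v = (\<lambda>z. (Y z - z\<^sub>0) / (z - z\<^sub>0) ^ M)"
  have u: "(u \<longlongrightarrow> C) (at z\<^sub>0)" and v: "(v \<longlongrightarrow> C) (at z\<^sub>0)"
    using X Y by (auto simp: leading_term_def u_def v_def)
  have "isCont k z\<^sub>0"
    using fact(3,4) holomorphic_on_imp_continuous_on[of k "ball z\<^sub>0 r"]
    by (simp add: continuous_on_eq_continuous_at)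
  then have kX: "((\<lambda>z. k (X z)) \<longlongrightarrow> c) (at z\<^sub>0)"
    using isCont_tendsto_compose[OF _ lim(1), of k] fact(6) N' by simp
  \<comment> \<open>Writing \<open>h w = z\<^sub>0 + (w - z\<^sub>0)^N k w\<close>, the variation of the unit factor \<open>k\<close> is of higher order.\<close>
  have small: "((\<lambda>z. (k (X z) - k (Y z)) / (z - z\<^sub>0) ^ p) \<longlongrightarrow> 0) (at z\<^sub>0)"
  proof (rule Lim_null_comparison)
    show "\<forall>\<^sub>F z in at z\<^sub>0. norm ((k (X z) - k (Y z)) / (z - z\<^sub>0) ^ p)
            \<le> L * norm ((X z - Y z) / (z - z\<^sub>0) ^ p)"
      using ball
    proof eventually_elim
      case (elim z)
      show ?case
        using divide_right_mono[OF L(3)[OF elim], of "norm ((z - z\<^sub>0) ^ p)"]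
        by (simp add: norm_divide)
    qed
    have "((\<lambda>z. (X z - Y z) / (z - z\<^sub>0) ^ p) \<longlongrightarrow> 0) (at z\<^sub>0)"
      using tendsto_quotient_lower_order[OF diff, of p] \<open>M > 0\<close> by simp
    then show "((\<lambda>z. L * norm ((X z - Y z) / (z - z\<^sub>0) ^ p)) \<longlongrightarrow> 0) (at z\<^sub>0)"
      by (intro tendsto_mult_right_zero tendsto_norm_zero)
  qed
  have "((\<lambda>z. (X z - Y z) / (z - z\<^sub>0) ^ (M + p) * (\<Sum>i<N. v z ^ (N - Suc i) * u z ^ i) * k (X z)
            + v z ^ N * ((k (X z) - k (Y z)) / (z - z\<^sub>0) ^ p))
          \<longlongrightarrow> A * (\<Sum>i<N. C ^ (N - Suc i) * C ^ i) * c + C ^ N * 0) (at z\<^sub>0)"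
    by (intro tendsto_intros diff u v kX small)
  moreover have "(\<Sum>i<N. C ^ (N - Suc i) * C ^ i) = of_nat N * C ^ (N - 1)"
  proof -
    have "(\<Sum>i<N. C ^ (N - Suc i) * C ^ i) = (\<Sum>i<N. C ^ (N - 1))"
      by (rule sum.cong) (auto simp flip: power_add)
    then show ?thesis by simp
  qed
  ultimately have main: "((\<lambda>z. (X z - Y z) / (z - z\<^sub>0) ^ (M + p) * (\<Sum>i<N. v z ^ (N - Suc i) * u z ^ i) * k (X z)
            + v z ^ N * ((k (X z) - k (Y z)) / (z - z\<^sub>0) ^ p))
          \<longlongrightarrow> of_nat N * c * C ^ (N - 1) * A) (at z\<^sub>0)"
    by (simp add: mult_ac)
  moreover have "\<forall>\<^sub>F z in at z\<^sub>0.
      (X z - Y z) / (z - z\<^sub>0) ^ (M + p) * (\<Sum>i<N. v z ^ (N - Suc i) * u z ^ i) * k (X z)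
            + v z ^ N * ((k (X z) - k (Y z)) / (z - z\<^sub>0) ^ p)
      = (h (X z) - h (Y z)) / (z - z\<^sub>0) ^ (M * N + p)"
    using ball ne
  proof eventually_elim
    case (elim z)
    define q where "q = (z - z\<^sub>0) ^ M"
    have q: "q \<noteq> 0" "X z - z\<^sub>0 = u z * q" "Y z - z\<^sub>0 = v z * q"
      using elim by (auto simp: q_def u_def v_def)
    have "h (X z) - z\<^sub>0 = (u z * q) ^ N * k (X z)" "h (Y z) - z\<^sub>0 = (v z * q) ^ N * k (Y z)"
      using fact(5)[of "X z"] fact(5)[of "Y z"] elim L(2) q N' by auto
    then have "h (X z) - h (Y z) = q ^ N * (u z ^ N * k (X z) - v z ^ N * k (Y z))"
      by (simp add: power_mult_distrib algebra_simps)
    also have "\<dots> = q ^ N * ((u z ^ N - v z ^ N) * k (X z) + v z ^ N * (k (X z) - k (Y z)))"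
      by (simp add: algebra_simps)
    finally have hXY: "h (X z) - h (Y z) = \<dots>" .
    have "(X z - Y z) = (u z - v z) * q"
      using q by (simp add: algebra_simps)
    then have "(X z - Y z) / (z - z\<^sub>0) ^ (M + p) = (u z - v z) / (z - z\<^sub>0) ^ p"
      using q(1) by (simp add: power_add q_def)
    then have "(X z - Y z) / (z - z\<^sub>0) ^ (M + p) * (\<Sum>i<N. v z ^ (N - Suc i) * u z ^ i)
               = (u z ^ N - v z ^ N) / (z - z\<^sub>0) ^ p"
      by (simp add: power_diff_sumr2)
    moreover have "(z - z\<^sub>0) ^ (M * N + p) = q ^ N * (z - z\<^sub>0) ^ p"
      by (simp add: power_add power_mult q_def)
    ultimately show ?case
      unfolding hXY using q(1) by (simp add: add_divide_distrib)
  qed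
  ultimately show ?thesis
    by (simp add: tendsto_cong)
qed

section \<open>Pairs of maps of the same order that generate no free semigroup\<close>

lemma word_map_simps:
  "word_map [] = id" "word_map (h # w) = h \<circ> word_map w"
  by (simp_all add: word_map_def)

lemma word_map_append: "word_map (v @ w) = word_map v \<circ> word_map w"
  by (induction v) (simp_all add: word_map_simps comp_assoc)

lemma id_fixing: "id \<in> fixing_entire_maps z\<^sub>0"
proof -
  have "\<not> (id :: complex \<Rightarrow> complex) constant_on UNIV"
    unfolding constant_on_def by (metis UNIV_I id_apply zero_neq_one)
  then show ?thesis
    by (simp add: fixing_entire_maps_def holomorphic_on_id)
qed

lemma word_map_fixing:
  fixes w :: "(complex \<Rightarrow> complex) list"
  assumes "w \<in> lists B" "B \<subseteq> fixing_entire_maps z\<^sub>0"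
  shows "word_map w \<in> fixing_entire_maps z\<^sub>0"
  using assms
proof (induction w)
  case Nil
  show ?case unfolding word_map_simps by (rule id_fixing)
next
  case (Cons h w)
  then have "h \<in> fixing_entire_maps z\<^sub>0" "word_map w \<in> fixing_entire_maps z\<^sub>0" by auto
  then show ?case unfolding word_map_simps by (rule fixing_entire_maps_comp)
qed

lemma leading_term_word_map:
  fixes w :: "(complex \<Rightarrow> complex) list"
  assumes "w \<in> lists B" "N > 0" "\<And>h. h \<in> B \<Longrightarrow> \<exists>c. leading_term z\<^sub>0 h N c"
  shows "\<exists>c. leading_term z\<^sub>0 (word_map w) (N ^ length w) c"
  using assms(1)
proof (induction w)
  case Nil
  have "leading_term z\<^sub>0 (word_map []) (N ^ length ([] :: (complex \<Rightarrow> complex) list)) 1"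
    using leading_term_id[of z\<^sub>0] by (simp add: word_map_simps)
  then show ?case by blast
next
  case (Cons h w)
  then obtain c e where "leading_term z\<^sub>0 h N c" "leading_term z\<^sub>0 (word_map w) (N ^ length w) e"
    using assms(3)[of h] by auto
  then have "leading_term z\<^sub>0 (h \<circ> word_map w) (N ^ length w * N) (c * e ^ N)"
    using assms(2) by (intro leading_term_comp) auto
  then have "leading_term z\<^sub>0 (word_map (h # w)) (N ^ length (h # w)) (c * e ^ N)"
    by (simp add: word_map_simps mult.commute)
  then show ?case by blast
qed

text \<open>Words of different lengths have different orders at \<open>z\<^sub>0\<close>, and a common last letter can be cancelled.
So only words of equal length that end in different letters have to be told apart.\<close>

lemma free_basis_pairI:
  fixes h k :: "complex \<Rightarrow> complex"
  assumes fixing: "{h, k} \<subseteq> fixing_entire_maps z\<^sub>0"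
    and "leading_term z\<^sub>0 h N c" "leading_term z\<^sub>0 k N e" "N \<ge> 2"
    and ends: "\<And>u v. u \<in> lists {h, k} \<Longrightarrow> v \<in> lists {h, k} \<Longrightarrow> length u = length v \<Longrightarrow>
      word_map (u @ [h]) \<noteq> word_map (v @ [k])"
  shows "free_basis {h, k}"
proof -
  have same_length: "v = w"
    if "length v = n" "length w = n" "v \<in> lists {h, k}" "w \<in> lists {h, k}" "word_map v = word_map w"
    for n v w
    using that
  proof (induction n arbitrary: v w)
    case 0
    then show ?case by simp
  next
    case (Suc n)
    obtain v' a where v: "v = v' @ [a]"
      using Suc.prems(1) by (metis length_Suc_conv_rev)
    obtain w' b where w: "w = w' @ [b]"
      using Suc.prems(2) by (metis length_Suc_conv_rev)
    have letters: "a \<in> {h, k}" "b \<in> {h, k}" "v' \<in> lists {h, k}" "w' \<in> lists {h, k}"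
      "length v' = n" "length w' = n"
      using Suc.prems v w by auto
    have "a = b"
    proof (rule ccontr)
      assume "a \<noteq> b"
      then consider "a = h" "b = k" | "a = k" "b = h"
        using letters by auto
      then show False
        using ends[of v' w'] ends[of w' v'] letters Suc.prems(5) v w by cases auto
    qed
    have "word_map v' \<circ> a = word_map w' \<circ> a"
      using Suc.prems(5) \<open>a = b\<close> unfolding v w word_map_append by (simp only: word_map_simps comp_id)
    moreover have "word_map v' \<in> fixing_entire_maps z\<^sub>0" "word_map w' \<in> fixing_entire_maps z\<^sub>0"
      "a \<in> fixing_entire_maps z\<^sub>0"
      using word_map_fixing[OF letters(3) fixing] word_map_fixing[OF letters(4) fixing]
        letters(1) fixing by auto
    ultimately have "word_map v' = word_map w'"
      by (rule fixing_right_cancel)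
    then have "v' = w'"
      using Suc.IH letters by blast
    then show ?case
      using v w \<open>a = b\<close> by simp
  qed
  have "length v = length w"
    if vw: "v \<in> lists {h, k}" "w \<in> lists {h, k}" "word_map v = word_map w" for v w
  proof -
    have lead: "\<exists>c. leading_term z\<^sub>0 (word_map x) (N ^ length x) c" if "x \<in> lists {h, k}" for x
    proof (rule leading_term_word_map[OF that])
      show "N > 0" using assms(4) by simp
      show "\<exists>c. leading_term z\<^sub>0 s N c" if "s \<in> {h, k}" for s
        using that assms(2,3) by blast
    qed
    obtain c where c: "leading_term z\<^sub>0 (word_map v) (N ^ length v) c"
      using lead[OF vw(1)] by blast
    obtain e where e: "leading_term z\<^sub>0 (word_map w) (N ^ length w) e"
      using lead[OF vw(2)] by blast
    have "N ^ length v = N ^ length w"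
      using leading_term_unique(1)[OF c] e vw(3) by simp
    then show ?thesis
      using assms(4) by (simp add: power_inject_exp)
  qed
  then show ?thesis
    unfolding free_basis_def using same_length by (intro inj_onI) blast
qed

text \<open>The relative order of the difference is that of \<open>h - k\<close>, whatever precedes the last letters. Adding an
outer letter preserves the relative order \<open>p\<close> of the inner difference, by \<open>difference_comp_left\<close>.
Exchanging the outer letter itself contributes a difference of relative order \<open>M p > p\<close>, where
\<open>M \<ge> 2\<close> is the order of the inner word, and cannot cancel the first contribution.\<close>

lemma words_differ_to_fixed_relative_order:
  fixes h k :: "complex \<Rightarrow> complex"
  assumes "{h, k} \<subseteq> fixing_entire_maps z\<^sub>0"
    and lead: "leading_term z\<^sub>0 h N c" "leading_term z\<^sub>0 k N c" and "N \<ge> 2" "p > 0"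
    and diff: "((\<lambda>z. (h z - k z) / (z - z\<^sub>0) ^ (N + p)) \<longlongrightarrow> a) (at z\<^sub>0)" and "a \<noteq> 0"
    and "length u = length v" "u \<in> lists {h, k}" "v \<in> lists {h, k}"
  shows "\<exists>A C. A \<noteq> 0 \<and> leading_term z\<^sub>0 (word_map (u @ [h])) (N ^ Suc (length u)) C
     \<and> leading_term z\<^sub>0 (word_map (v @ [k])) (N ^ Suc (length u)) C
     \<and> ((\<lambda>z. (word_map (u @ [h]) z - word_map (v @ [k]) z) / (z - z\<^sub>0) ^ (N ^ Suc (length u) + p))
           \<longlongrightarrow> A) (at z\<^sub>0)"
  using assms(8-10)
proof (induction u v rule: list_induct2)
  case Nil
  show ?case
    using lead diff \<open>a \<noteq> 0\<close> by (intro exI[of _ a] exI[of _ c]) (simp add: word_map_simps)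
next
  case (Cons s u t v)
  define X where "X = word_map (u @ [h])"
  define Y where "Y = word_map (v @ [k])"
  define M where "M = N ^ Suc (length u)"
  have "M \<ge> N ^ 1"
    unfolding M_def using \<open>N \<ge> 2\<close> by (intro power_increasing) auto
  then have "M \<ge> 2" using \<open>N \<ge> 2\<close> by simp
  have letters: "s \<in> {h, k}" "t \<in> {h, k}" "u \<in> lists {h, k}" "v \<in> lists {h, k}"
    using Cons.prems by auto
  obtain A C where IH: "A \<noteq> 0" "leading_term z\<^sub>0 X M C" "leading_term z\<^sub>0 Y M C"
    "((\<lambda>z. (X z - Y z) / (z - z\<^sub>0) ^ (M + p)) \<longlongrightarrow> A) (at z\<^sub>0)"
    using Cons.IH[OF letters(3,4)] unfolding X_def Y_def M_def by blast
  have s: "s \<in> fixing_entire_maps z\<^sub>0" "leading_term z\<^sub>0 s N c"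
    and t: "t \<in> fixing_entire_maps z\<^sub>0" "leading_term z\<^sub>0 t N c"
    using letters assms(1) lead by auto
  have inner: "((\<lambda>z. (s (X z) - s (Y z)) / (z - z\<^sub>0) ^ (M * N + p))
      \<longlongrightarrow> of_nat N * c * C ^ (N - 1) * A) (at z\<^sub>0)"
    using difference_comp_left[OF s IH(2,3) _ IH(4)] \<open>M \<ge> 2\<close> by simp
  obtain e where e: "((\<lambda>w. (s w - t w) / (w - z\<^sub>0) ^ (N + p)) \<longlongrightarrow> e) (at z\<^sub>0)"
  proof -
    consider "s = t" | "s = h" "t = k" | "s = k" "t = h"
      using letters by auto
    then show thesis
    proof cases
      case 1
      then show thesis using that[of 0] by simp
    next
      case 2
      then show thesis using that[OF diff[folded 2]] by blast
    next
      case 3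
      have "((\<lambda>z. - ((h z - k z) / (z - z\<^sub>0) ^ (N + p))) \<longlongrightarrow> - a) (at z\<^sub>0)"
        using diff by (rule tendsto_minus)
      then show thesis using that[of "- a"] 3 by (simp add: minus_divide_left)
    qed
  qed
  have Y_lim: "filterlim Y (at z\<^sub>0) (at z\<^sub>0)"
    using leading_term_tendsto[OF IH(3)] \<open>M \<ge> 2\<close> by simp
  \<comment> \<open>The total exponent is \<open>M (N + p) = (M N + p) + (M p - p)\<close>; the second summand is positive, so that
    the contribution of the outer letters vanishes in the limit.\<close>
  have "((\<lambda>z. (s (Y z) - t (Y z)) / (Y z - z\<^sub>0) ^ (N + p) * ((Y z - z\<^sub>0) / (z - z\<^sub>0) ^ M) ^ (N + p)
      * (z - z\<^sub>0) ^ (M * p - p)) \<longlongrightarrow> e * C ^ (N + p) * 0) (at z\<^sub>0)"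
  proof (intro tendsto_mult tendsto_power tendsto_power_shift)
    show "((\<lambda>z. (s (Y z) - t (Y z)) / (Y z - z\<^sub>0) ^ (N + p)) \<longlongrightarrow> e) (at z\<^sub>0)"
      using filterlim_compose[OF e Y_lim] .
    show "((\<lambda>z. (Y z - z\<^sub>0) / (z - z\<^sub>0) ^ M) \<longlongrightarrow> C) (at z\<^sub>0)"
      using IH(3) by (simp add: leading_term_def)
    have "1 * p < M * p" using \<open>M \<ge> 2\<close> \<open>p > 0\<close> by (intro mult_strict_right_mono) auto
    then show "0 < M * p - p" by simp
  qed
  moreover have "\<forall>\<^sub>F z in at z\<^sub>0.
      (s (Y z) - t (Y z)) / (Y z - z\<^sub>0) ^ (N + p) * ((Y z - z\<^sub>0) / (z - z\<^sub>0) ^ M) ^ (N + p)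
        * (z - z\<^sub>0) ^ (M * p - p)
      = (s (Y z) - t (Y z)) / (z - z\<^sub>0) ^ (M * N + p)"
  proof -
    have "\<forall>\<^sub>F z in at z\<^sub>0. Y z \<noteq> z\<^sub>0"
      using Y_lim by (simp add: filterlim_at)
    moreover have "\<forall>\<^sub>F z in at z\<^sub>0. z \<noteq> z\<^sub>0"
      by (rule eventually_neq_at_within)
    ultimately show ?thesis
    proof eventually_elim
      case (elim z)
      have "p \<le> M * p" using \<open>M \<ge> 2\<close> by simp
      then have "M * (N + p) = (M * N + p) + (M * p - p)"
        unfolding distrib_left by linarith
      then have "((z - z\<^sub>0) ^ M) ^ (N + p) = (z - z\<^sub>0) ^ (M * N + p) * (z - z\<^sub>0) ^ (M * p - p)"
        by (simp flip: power_mult power_add)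
      then show ?case
        using elim by (simp add: power_divide)
    qed
  qed
  ultimately have outer:
    "((\<lambda>z. (s (Y z) - t (Y z)) / (z - z\<^sub>0) ^ (M * N + p)) \<longlongrightarrow> 0) (at z\<^sub>0)"
    by (simp add: tendsto_cong)
  have "((\<lambda>z. (s (X z) - t (Y z)) / (z - z\<^sub>0) ^ (M * N + p))
      \<longlongrightarrow> of_nat N * c * C ^ (N - 1) * A) (at z\<^sub>0)"
    using tendsto_add[OF inner outer] by (simp flip: add_divide_distrib)
  moreover have "of_nat N * c * C ^ (N - 1) * A \<noteq> 0"
    using IH(1,2) s(2) \<open>N \<ge> 2\<close> by (simp add: leading_term_def)
  moreover have "leading_term z\<^sub>0 (s \<circ> X) (M * N) (c * C ^ N)"
    "leading_term z\<^sub>0 (t \<circ> Y) (M * N) (c * C ^ N)"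
    using leading_term_comp[OF s(2) IH(2)] leading_term_comp[OF t(2) IH(3)] \<open>M \<ge> 2\<close> by auto
  moreover have "N ^ Suc (length (s # u)) = M * N"
    by (simp add: M_def)
  moreover have "word_map ((s # u) @ [h]) = s \<circ> X" "word_map ((t # v) @ [k]) = t \<circ> Y"
    by (simp_all add: word_map_simps X_def Y_def)
  ultimately have "of_nat N * c * C ^ (N - 1) * A \<noteq> 0
     \<and> leading_term z\<^sub>0 (word_map ((s # u) @ [h])) (N ^ Suc (length (s # u))) (c * C ^ N)
     \<and> leading_term z\<^sub>0 (word_map ((t # v) @ [k])) (N ^ Suc (length (s # u))) (c * C ^ N)
     \<and> ((\<lambda>z. (word_map ((s # u) @ [h]) z - word_map ((t # v) @ [k]) z)
             / (z - z\<^sub>0) ^ (N ^ Suc (length (s # u)) + p))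
           \<longlongrightarrow> of_nat N * c * C ^ (N - 1) * A) (at z\<^sub>0)"
    by (simp add: mult.commute[of N M])
  then show ?case by blast
qed

lemma free_basis_equal_leading_coefficients:
  fixes h k :: "complex \<Rightarrow> complex"
  assumes "{h, k} \<subseteq> fixing_entire_maps z\<^sub>0"
    and "leading_term z\<^sub>0 h N c" "leading_term z\<^sub>0 k N c" "N \<ge> 2" "h \<noteq> k"
  shows "free_basis {h, k}"
proof (rule free_basis_pairI[OF assms(1-4)])
  fix u v assume uv: "u \<in> lists {h, k}" "v \<in> lists {h, k}" "length u = length v"
  obtain p a where pa: "p > 0" "a \<noteq> 0"
    "((\<lambda>z. (h z - k z) / (z - z\<^sub>0) ^ (N + p)) \<longlongrightarrow> a) (at z\<^sub>0)"
    using difference_order[OF _ _ assms(2,3,5)] assms(1) by auto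
  show "word_map (u @ [h]) \<noteq> word_map (v @ [k])"
  proof
    assume "word_map (u @ [h]) = word_map (v @ [k])"
    moreover obtain A where "A \<noteq> 0"
      "((\<lambda>z. (word_map (u @ [h]) z - word_map (v @ [k]) z) / (z - z\<^sub>0) ^ (N ^ Suc (length u) + p))
         \<longlongrightarrow> A) (at z\<^sub>0)"
      using words_differ_to_fixed_relative_order[OF assms(1-4) pa(1,3,2) uv(3,1,2)] by blast
    ultimately show False
      by (simp add: tendsto_const_iff)
  qed
qed

text \<open>Composing with an outer letter raises the old coefficient to the power \<open>N\<close> and multiplies it by \<open>c\<close> or
\<open>c r\<close>. Hence the exponent of \<open>r\<close> is the number whose base \<open>N\<close> digits, least significant first, mark the
positions of \<open>k\<close>, while the remaining factor depends on the length only.\<close>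

lemma leading_coefficient_word_map:
  fixes h k :: "complex \<Rightarrow> complex"
  assumes "leading_term z\<^sub>0 h N c" "leading_term z\<^sub>0 k N (c * r)" "N > 0"
  shows "\<exists>e. \<forall>w \<in> lists {h, k}. length w = n \<longrightarrow>
    leading_term z\<^sub>0 (word_map w) (N ^ n) (e * r ^ horner_sum (\<lambda>s. of_bool (s = k)) N w)"
proof (induction n)
  case 0
  show ?case
  proof (intro exI[of _ 1] ballI impI)
    fix w :: "(complex \<Rightarrow> complex) list"
    assume "length w = 0"
    then show "leading_term z\<^sub>0 (word_map w) (N ^ 0)
        (1 * r ^ horner_sum (\<lambda>s. of_bool (s = k)) N w)"
      using leading_term_id[of z\<^sub>0] by (simp add: word_map_simps)
  qed
next
  case (Suc n)
  then obtain e where e: "\<And>w. w \<in> lists {h, k} \<Longrightarrow> length w = n \<Longrightarrow>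
    leading_term z\<^sub>0 (word_map w) (N ^ n) (e * r ^ horner_sum (\<lambda>s. of_bool (s = k)) N w)"
    by blast
  show ?case
  proof (intro exI[of _ "c * e ^ N"] ballI impI)
    fix w assume w: "w \<in> lists {h, k}" "length w = Suc n"
    then obtain s v where sv: "w = s # v" "s \<in> {h, k}" "v \<in> lists {h, k}" "length v = n"
      by (cases w) auto
    define d where "d = horner_sum (\<lambda>s. of_bool (s = k)) N v"
    have "leading_term z\<^sub>0 s N (c * r ^ of_bool (s = k))"
      using sv(2) assms(1,2) by auto
    then have "leading_term z\<^sub>0 (s \<circ> word_map v) (N ^ n * N)
        (c * r ^ of_bool (s = k) * (e * r ^ d) ^ N)"
      unfolding d_def using assms(3) by (intro leading_term_comp e sv) auto
    moreover have "c * r ^ of_bool (s = k) * (e * r ^ d) ^ N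
        = c * e ^ N * r ^ (of_bool (s = k) + N * d)"
      by (simp add: power_add power_mult_distrib mult_ac flip: power_mult)
    moreover have digits: "horner_sum (\<lambda>s. of_bool (s = k)) N (s # v) = of_bool (s = k) + N * d"
      by (simp add: d_def)
    ultimately show "leading_term z\<^sub>0 (word_map w) (N ^ Suc n)
        (c * e ^ N * r ^ horner_sum (\<lambda>s. of_bool (s = k)) N w)"
      by (simp only: sv(1) word_map_simps digits power_Suc2)
  qed
qed

lemma horner_sum_less_power:
  fixes N :: nat
  assumes "N \<ge> 2"
  shows "horner_sum (\<lambda>s. of_bool (P s)) N w < N ^ length w"
proof (induction w)
  case Nil
  then show ?case by simp
next
  case (Cons s w)
  have "of_bool (P s) + N * horner_sum (\<lambda>s. of_bool (P s)) N w
      < N + N * horner_sum (\<lambda>s. of_bool (P s)) N w"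
    using assms by (cases "P s") auto
  also have "\<dots> = N * Suc (horner_sum (\<lambda>s. of_bool (P s)) N w)"
    by simp
  also have "\<dots> \<le> N * N ^ length w"
    using Cons.IH by (intro mult_le_mono2) simp
  finally show ?case by simp
qed

lemma free_basis_independent_leading_coefficients:
  fixes h k :: "complex \<Rightarrow> complex"
  assumes "{h, k} \<subseteq> fixing_entire_maps z\<^sub>0"
    and "leading_term z\<^sub>0 h N c" "leading_term z\<^sub>0 k N e" "N \<ge> 2"
    and not_root: "\<And>j. j > 0 \<Longrightarrow> c ^ j \<noteq> e ^ j"
  shows "free_basis {h, k}"
proof (rule free_basis_pairI[OF assms(1-4)])
  fix u v assume uv: "u \<in> lists {h, k}" "v \<in> lists {h, k}" "length u = length v"
  have nz: "c \<noteq> 0" "e \<noteq> 0"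
    using assms(2,3) by (auto simp: leading_term_def)
  define r where "r = e / c"
  have e: "e = c * r" using nz by (simp add: r_def)
  have "c \<noteq> e" using not_root[of 1] by simp
  then have "h \<noteq> k" using leading_term_unique(2)[OF assms(2)] assms(3) by blast
  define d where "d = (\<lambda>w. horner_sum (\<lambda>s. of_bool (s = k)) N w)"
  obtain b where b: "\<forall>w \<in> lists {h, k}. length w = Suc (length u) \<longrightarrow>
    leading_term z\<^sub>0 (word_map w) (N ^ Suc (length u)) (b * r ^ d w)"
    using leading_coefficient_word_map[of z\<^sub>0 h N c k r] assms(2-4) unfolding d_def e by fastforce
  show "word_map (u @ [h]) \<noteq> word_map (v @ [k])"
  proof
    assume eq: "word_map (u @ [h]) = word_map (v @ [k])"
    have "leading_term z\<^sub>0 (word_map (u @ [h])) (N ^ Suc (length u)) (b * r ^ d (u @ [h]))"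
      "leading_term z\<^sub>0 (word_map (v @ [k])) (N ^ Suc (length u)) (b * r ^ d (v @ [k]))"
      using b uv by auto
    then have "b * r ^ d (u @ [h]) = b * r ^ d (v @ [k])" "b \<noteq> 0"
      using leading_term_unique(2) eq by (metis, simp add: leading_term_def)
    moreover have "d (u @ [h]) = d u" "d (v @ [k]) = d v + N ^ length u"
      using \<open>h \<noteq> k\<close> uv(3) by (simp_all add: d_def horner_sum_append)
    ultimately have "r ^ d u = r ^ (d v + N ^ length u)" by simp
    \<comment> \<open>The last letters are the leading digits, so the two exponents of \<open>r\<close> differ.\<close>
    moreover have less: "d u < d v + N ^ length u"
      using horner_sum_less_power[OF assms(4), of "\<lambda>s. s = k" u] by (simp add: d_def)
    ultimately have "r ^ (d v + N ^ length u - d u) = 1"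
      using nz by (simp add: power_diff r_def)
    then show False
      using not_root[of "d v + N ^ length u - d u"] less nz
      by (simp add: r_def power_divide field_simps)
  qed
qed

section \<open>Semigroups without free non-cyclic subsemigroups\<close>

lemma no_free_pair:
  assumes "\<not> (\<exists>T \<subseteq> generated_semigroup A. free_noncyclic_semigroup T)"
    and "h \<in> generated_semigroup A" "k \<in> generated_semigroup A" "h \<noteq> k"
  shows "\<not> free_basis {h, k}"
proof
  assume "free_basis {h, k}"
  then have "free_noncyclic_semigroup (generated_semigroup {h, k})"
    unfolding free_noncyclic_semigroup_def using assms(4) by blast
  moreover have "generated_semigroup {h, k} \<subseteq> generated_semigroup A"
    using assms(2,3) by (intro generated_semigroup_mono) auto
  ultimately show False using assms(1) by blast
qed

lemma no_free_same_order:
  assumes "A \<subseteq> fixing_entire_maps z\<^sub>0"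
    and "\<not> (\<exists>T \<subseteq> generated_semigroup A. free_noncyclic_semigroup T)"
    and "h \<in> generated_semigroup A" "k \<in> generated_semigroup A"
    and "leading_term z\<^sub>0 h N c" "leading_term z\<^sub>0 k N e" "N \<ge> 2"
  shows no_free_leading_coefficient_ratio: "\<exists>j>0. c ^ j = e ^ j"
    and no_free_leading_coefficient_inj: "c = e \<Longrightarrow> h = k"
proof -
  have fixing: "{h, k} \<subseteq> fixing_entire_maps z\<^sub>0"
    using generated_semigroup_subset_fixing[OF assms(1)] assms(3,4) by blast
  show "\<exists>j>0. c ^ j = e ^ j"
  proof (rule ccontr)
    assume no_root: "\<not> (\<exists>j>0. c ^ j = e ^ j)"
    have "h \<noteq> k"
    proof
      assume "h = k"
      then have "c = e" using leading_term_unique(2)[OF assms(5)] assms(6) by simp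
      then show False using no_root by auto
    qed
    moreover have "free_basis {h, k}"
      using free_basis_independent_leading_coefficients[OF fixing assms(5-7)] no_root by blast
    ultimately show False
      using no_free_pair[OF assms(2-4)] by blast
  qed
  show "h = k" if "c = e"
    using free_basis_equal_leading_coefficients[OF fixing assms(5) _ assms(7)] assms(6)
      no_free_pair[OF assms(2-4)] that by blast
qed

lemma leading_term_funpow:
  assumes "leading_term z\<^sub>0 h N c" "N > 0"
  shows "\<exists>e. leading_term z\<^sub>0 (h ^^ n) (N ^ n) e"
proof (induction n)
  case 0
  have "leading_term z\<^sub>0 (h ^^ 0) (N ^ 0) 1"
    using leading_term_id[of z\<^sub>0] by simp
  then show ?case by blast
next
  case (Suc n)
  then obtain e where "leading_term z\<^sub>0 (h ^^ n) (N ^ n) e" by blast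
  then have "leading_term z\<^sub>0 (h \<circ> h ^^ n) (N ^ n * N) (c * e ^ N)"
    using assms by (intro leading_term_comp) auto
  then have "leading_term z\<^sub>0 (h ^^ Suc n) (N ^ Suc n) (c * e ^ N)"
    by (simp add: mult.commute)
  then show ?case by blast
qed

definition order_class ::
    "complex \<Rightarrow> (complex \<Rightarrow> complex) set \<Rightarrow> nat \<Rightarrow> (complex \<Rightarrow> complex) set" where
  "order_class z\<^sub>0 S N = {h \<in> S. \<exists>c. leading_term z\<^sub>0 h N c}"

text \<open>If \<open>g\<close> has leading coefficient \<open>a = \<kappa>^(m - 1)\<close>, then it becomes monic in the coordinate
\<open>\<kappa> (z - z\<^sub>0)\<close>, and a leading term \<open>c (z - z\<^sub>0)^N\<close> becomes \<open>c \<kappa>^(1 - N)\<close> in place of \<open>c\<close>. The equation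
\<open>(c \<kappa>)^K = \<kappa>^(N K)\<close> says that this normalised coefficient is a \<open>K\<close>-th root of unity. It holds for
\<open>f\<close> because \<open>f \<circ> g\<close> and \<open>g \<circ> f\<close> have the same order, and it is inherited by compositions.\<close>

lemma no_free_order_class_bounded:
  assumes fixing: "{f, g} \<subseteq> fixing_entire_maps z\<^sub>0"
    and f: "leading_term z\<^sub>0 f d b" "d \<ge> 2" and g: "leading_term z\<^sub>0 g m a" "m \<ge> 2"
    and no_free: "\<not> (\<exists>T \<subseteq> generated_semigroup {f, g}. free_noncyclic_semigroup T)"
  shows "\<exists>K. \<forall>N. finite (order_class z\<^sub>0 (generated_semigroup {f, g}) N)
             \<and> card (order_class z\<^sub>0 (generated_semigroup {f, g}) N) \<le> K"
proof -
  have nz: "a \<noteq> 0" "b \<noteq> 0"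
    using f g by (auto simp: leading_term_def)
  have gens: "f \<in> generated_semigroup {f, g}" "g \<in> generated_semigroup {f, g}"
    by (auto intro: generated_semigroup.generator)
  have "leading_term z\<^sub>0 (f \<circ> g) (m * d) (b * a ^ d)"
    using f g by (intro leading_term_comp) auto
  moreover have "leading_term z\<^sub>0 (g \<circ> f) (m * d) (a * b ^ m)"
    using leading_term_comp[OF g(1) f(1)] f by (simp add: mult.commute)
  moreover have "m * d \<ge> 2"
    using f(2) g(2) mult_le_mono[of 2 m 1 d] by simp
  ultimately obtain j where j: "j > 0" "(b * a ^ d) ^ j = (a * b ^ m) ^ j"
    using no_free_leading_coefficient_ratio[OF fixing no_free
        generated_semigroup.comp[OF gens] generated_semigroup.comp[OF gens(2,1)]] by blast
  obtain \<kappa> where \<kappa>: "\<kappa> \<noteq> 0" "a = \<kappa> ^ (m - 1)"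
    using exists_complex_root_nonzero[OF nz(1), of "m - 1"] g(2) by auto
  define K where "K = (m - 1) * j"
  have "K > 0" using g(2) j(1) by (simp add: K_def)
  have pow_m: "x ^ m = x * x ^ (m - 1)" for x :: complex
    using g(2) by (cases m) auto
  have a_K: "(a * \<kappa>) ^ K = \<kappa> ^ (m * K)"
  proof -
    have "a * \<kappa> = \<kappa> ^ m"
      unfolding \<kappa>(2) using pow_m[of \<kappa>] by (simp add: mult.commute)
    then show ?thesis by (simp add: power_mult)
  qed
  have b_K: "(b * \<kappa>) ^ K = \<kappa> ^ (d * K)"
  proof -
    have "b ^ j * (a ^ d) ^ j = b ^ j * (a ^ j * b ^ K)"
    proof -
      have "b ^ K = (b ^ (m - 1)) ^ j"
        by (simp add: K_def power_mult)
      then show ?thesis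
        using j(2) pow_m[of b] by (simp add: power_mult_distrib mult_ac)
    qed
    then have "(a ^ d) ^ j = a ^ j * b ^ K"
      using nz by simp
    moreover have "(a ^ d) ^ j = \<kappa> ^ (d * K)" "a ^ j = \<kappa> ^ K"
      by (simp_all add: \<kappa>(2) K_def mult_ac flip: power_mult)
    ultimately show ?thesis by (simp add: power_mult_distrib mult.commute)
  qed
  have normal: "\<exists>N c. N \<ge> 2 \<and> leading_term z\<^sub>0 h N c \<and> (c * \<kappa>) ^ K = \<kappa> ^ (N * K)"
    if "h \<in> generated_semigroup {f, g}" for h
    using that
  proof induction
    case (generator h)
    then show ?case using f g a_K b_K by blast
  next
    case (comp s t)
    then obtain N c M e where s: "N \<ge> 2" "leading_term z\<^sub>0 s N c" "(c * \<kappa>) ^ K = \<kappa> ^ (N * K)"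
      and t: "M \<ge> 2" "leading_term z\<^sub>0 t M e" "(e * \<kappa>) ^ K = \<kappa> ^ (M * K)" by metis
    have "leading_term z\<^sub>0 (s \<circ> t) (M * N) (c * e ^ N)"
      using s t by (intro leading_term_comp) auto
    moreover have "M * N \<ge> 2"
      using s(1) t(1) mult_le_mono[of 2 M 1 N] by simp
    moreover have "(c * e ^ N * \<kappa>) ^ K = \<kappa> ^ (M * N * K)"
    proof -
      have "(c * e ^ N * \<kappa>) ^ K * \<kappa> ^ (N * K) = (c * \<kappa>) ^ K * ((e * \<kappa>) ^ K) ^ N"
        by (simp add: power_mult_distrib mult_ac flip: power_mult)
      also have "\<dots> = \<kappa> ^ (N * K) * \<kappa> ^ (M * N * K)"
        unfolding s(3) t(3) by (simp add: mult_ac flip: power_mult)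
      finally show ?thesis using \<kappa>(1) by simp
    qed
    ultimately show ?case by blast
  qed
  have "finite (order_class z\<^sub>0 (generated_semigroup {f, g}) N)
      \<and> card (order_class z\<^sub>0 (generated_semigroup {f, g}) N) \<le> K" for N
  proof -
    define H where "H = order_class z\<^sub>0 (generated_semigroup {f, g}) N"
    have H: "h \<in> generated_semigroup {f, g}" if "h \<in> H" for h
      using that by (simp add: H_def order_class_def)
    have "\<exists>c. leading_term z\<^sub>0 h N c \<and> N \<ge> 2 \<and> (c * \<kappa>) ^ K = \<kappa> ^ (N * K)" if "h \<in> H" for h
    proof -
      obtain M c where c: "M \<ge> 2" "leading_term z\<^sub>0 h M c" "(c * \<kappa>) ^ K = \<kappa> ^ (M * K)"
        using normal[OF H[OF \<open>h \<in> H\<close>]] by blast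
      have "M = N"
        using \<open>h \<in> H\<close> leading_term_unique(1)[OF c(2)] by (auto simp: H_def order_class_def)
      then show ?thesis using c by blast
    qed
    then obtain c where c: "\<And>h. h \<in> H \<Longrightarrow>
        leading_term z\<^sub>0 h N (c h) \<and> N \<ge> 2 \<and> (c h * \<kappa>) ^ K = \<kappa> ^ (N * K)"
      by metis
    define R where "R = {z. z ^ K = \<kappa> ^ (N * K)}"
    have R: "card R = K" "finite R"
      unfolding R_def using \<kappa>(1) \<open>K > 0\<close> by (auto intro: card_nth_roots finite_nth_roots)
    have into: "(\<lambda>h. c h * \<kappa>) ` H \<subseteq> R"
      using c by (auto simp: R_def)
    have inj: "inj_on (\<lambda>h. c h * \<kappa>) H"
    proof (rule inj_onI)
      fix h k assume hk: "h \<in> H" "k \<in> H" "c h * \<kappa> = c k * \<kappa>"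
      have "c h = c k"
        using hk(3) \<kappa>(1) by simp
      then show "h = k"
        using no_free_leading_coefficient_inj[OF fixing no_free H[OF hk(1)] H[OF hk(2)],
            of N "c h" "c k"] c[OF hk(1)] c[OF hk(2)] by blast
    qed
    show ?thesis
      using inj_on_finite[OF inj into R(2)] card_inj_on_le[OF inj into R(2)] R(1)
      unfolding H_def by simp
  qed
  then show ?thesis by blast
qed

lemma pigeonhole_sequence:
  fixes K :: nat
  assumes "finite C" "card C \<le> K" "\<And>i. i \<le> K \<Longrightarrow> q i \<in> C"
  obtains i j where "i < j" "j \<le> K" "q i = q j"
proof -
  have "card (q ` {..K}) \<le> K"
    using card_mono[of C "q ` {..K}"] assms by force
  then have "\<not> inj_on q {..K}"
    using card_image[of q "{..K}"] by auto
  then obtain i j where "i \<le> K" "j \<le> K" "i \<noteq> j" "q i = q j"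
    by (auto simp: inj_on_def)
  then show thesis
    using that[of i j] that[of j i] by (cases i j rule: linorder_cases) auto
qed

section \<open>Preperiodic points\<close>

lemma preperiodic_points_funpow:
  assumes "n > 0"
  shows "preperiodic_points (f ^^ n) = preperiodic_points f"
proof (intro equalityI subsetI)
  fix z assume "z \<in> preperiodic_points (f ^^ n)"
  then have "finite (range (\<lambda>i. ((f ^^ n) ^^ i) z))"
    by (simp add: preperiodic_points_def)
  then have "finite (\<Union>r<n. (f ^^ r) ` range (\<lambda>i. ((f ^^ n) ^^ i) z))"
    by blast
  moreover have "range (\<lambda>i. (f ^^ i) z) \<subseteq> (\<Union>r<n. (f ^^ r) ` range (\<lambda>i. ((f ^^ n) ^^ i) z))"
  proof
    fix y assume "y \<in> range (\<lambda>i. (f ^^ i) z)"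
    then obtain i where "y = (f ^^ i) z" by blast
    also have "\<dots> = (f ^^ (i mod n + n * (i div n))) z" by simp
    also have "\<dots> = (f ^^ (i mod n)) (((f ^^ n) ^^ (i div n)) z)"
      by (simp only: funpow_add funpow_mult o_apply)
    finally show "y \<in> (\<Union>r<n. (f ^^ r) ` range (\<lambda>i. ((f ^^ n) ^^ i) z))"
      using assms by force
  qed
  ultimately have "finite (range (\<lambda>i. (f ^^ i) z))"
    by (rule finite_subset[rotated])
  then show "z \<in> preperiodic_points f"
    by (simp add: preperiodic_points_def)
next
  fix z assume "z \<in> preperiodic_points f"
  then have "finite (range (\<lambda>i. (f ^^ i) z))"
    by (simp add: preperiodic_points_def)
  moreover have "range (\<lambda>i. ((f ^^ n) ^^ i) z) \<subseteq> range (\<lambda>i. (f ^^ i) z)"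
    by (auto simp: funpow_mult)
  ultimately have "finite (range (\<lambda>i. ((f ^^ n) ^^ i) z))"
    by (rule finite_subset[rotated])
  then show "z \<in> preperiodic_points (f ^^ n)"
    by (simp add: preperiodic_points_def)
qed

text \<open>With \<open>H = f^t\<close> the relation reads \<open>f^s \<circ> H = H \<circ> g^s\<close>. So \<open>H\<close> maps a finite orbit of \<open>g^s\<close> onto an orbit
of \<open>f^s\<close>, and a point is preperiodic for \<open>f\<close> as soon as its image under \<open>f^t\<close> is. The reverse inclusion
does not follow in this way, since \<open>H\<close> may have infinite fibres.\<close>

lemma preperiodic_points_subset:
  assumes rel: "f ^^ (t + s) = f ^^ t \<circ> g ^^ s" and "s > 0"
  shows "preperiodic_points g \<subseteq> preperiodic_points f"
proof
  fix z assume "z \<in> preperiodic_points g"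
  then have "z \<in> preperiodic_points (g ^^ s)"
    by (simp only: preperiodic_points_funpow[OF \<open>s > 0\<close>])
  then have fin: "finite (range (\<lambda>n. ((g ^^ s) ^^ n) z))"
    by (simp add: preperiodic_points_def)
  have step: "(f ^^ s) ((f ^^ t) w) = (f ^^ t) ((g ^^ s) w)" for w
    using fun_cong[OF rel, of w] by (simp add: add.commute[of t s] funpow_add)
  have "((f ^^ s) ^^ n) ((f ^^ t) z) = (f ^^ t) (((g ^^ s) ^^ n) z)" for n
    by (induction n) (simp_all add: step)
  then have "range (\<lambda>n. ((f ^^ s) ^^ n) ((f ^^ t) z)) = (f ^^ t) ` range (\<lambda>n. ((g ^^ s) ^^ n) z)"
    by auto
  then have "(f ^^ t) z \<in> preperiodic_points (f ^^ s)"
    using fin by (simp add: preperiodic_points_def)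
  then have "(f ^^ t) z \<in> preperiodic_points f"
    by (simp only: preperiodic_points_funpow[OF \<open>s > 0\<close>])
  then have "finite ((\<lambda>n. (f ^^ n) z) ` {..<t} \<union> range (\<lambda>n. (f ^^ n) ((f ^^ t) z)))"
    by (simp add: preperiodic_points_def)
  moreover have "range (\<lambda>n. (f ^^ n) z)
      \<subseteq> (\<lambda>n. (f ^^ n) z) ` {..<t} \<union> range (\<lambda>n. (f ^^ n) ((f ^^ t) z))"
  proof
    fix y assume "y \<in> range (\<lambda>n. (f ^^ n) z)"
    then obtain n where n: "y = (f ^^ n) z" by blast
    show "y \<in> (\<lambda>n. (f ^^ n) z) ` {..<t} \<union> range (\<lambda>n. (f ^^ n) ((f ^^ t) z))"
    proof (cases "n < t")
      case True
      then show ?thesis using n by blast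
    next
      case False
      then have "y = (f ^^ (n - t)) ((f ^^ t) z)"
        using n by (metis funpow_add le_add_diff_inverse2 not_less o_apply)
      then show ?thesis by blast
    qed
  qed
  ultimately have "finite (range (\<lambda>i. (f ^^ i) z))"
    by (rule finite_subset[rotated])
  then show "z \<in> preperiodic_points f"
    by (simp add: preperiodic_points_def)
qed

text \<open>The \<open>K + 1\<close> maps \<open>f^(i + 1) \<circ> g^(K + 1 - i)\<close>, \<open>i \<le> K\<close>, all have order \<open>M^(K + 2)\<close>, so two of them
coincide. Cancelling the common power of \<open>g\<close> on the right leaves the relation.\<close>

lemma same_order_relation:
  fixes f g :: "complex \<Rightarrow> complex"
  assumes "A \<subseteq> fixing_entire_maps z\<^sub>0"
    and bounded: "\<And>N. finite (order_class z\<^sub>0 (generated_semigroup A) N) \<and> card (order_class z\<^sub>0 (generated_semigroup A) N) \<le> K"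
    and f: "f \<in> generated_semigroup A" "leading_term z\<^sub>0 f M b" and g: "g \<in> generated_semigroup A" "leading_term z\<^sub>0 g M a" and "M > 0"
  obtains t s where "s > 0" "f ^^ (t + s) = f ^^ t \<circ> g ^^ s"
proof -
  note fixing = generated_semigroup_subset_fixing[OF assms(1)]
  note closed = generated_semigroup.comp[of _ A] funpow_in_generated_semigroup[of _ A]
  define q where "q = (\<lambda>i. f ^^ Suc i \<circ> g ^^ (Suc K - i))"
  have "q i \<in> order_class z\<^sub>0 (generated_semigroup A) (M ^ (K + 2))" if "i \<le> K" for i
    unfolding order_class_def mem_Collect_eq
  proof
    show "q i \<in> generated_semigroup A"
      unfolding q_def using f g that by (intro closed) auto
    obtain c e where ce: "leading_term z\<^sub>0 (f ^^ Suc i) (M ^ Suc i) c"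
      "leading_term z\<^sub>0 (g ^^ (Suc K - i)) (M ^ (Suc K - i)) e"
      using leading_term_funpow[OF f(2) \<open>M > 0\<close>] leading_term_funpow[OF g(2) \<open>M > 0\<close>] by blast
    have exponents: "M ^ (Suc K - i) * M ^ Suc i = M ^ (K + 2)"
      using \<open>i \<le> K\<close> by (subst power_add[symmetric]) simp
    have "M ^ (Suc K - i) > 0"
      using \<open>M > 0\<close> by simp
    from leading_term_comp[OF ce this] show "\<exists>c. leading_term z\<^sub>0 (q i) (M ^ (K + 2)) c"
      unfolding exponents q_def by blast
  qed
  then obtain i j where ij: "i < j" "j \<le> K" "q i = q j"
    using pigeonhole_sequence[of "order_class z\<^sub>0 (generated_semigroup A) (M ^ (K + 2))" K q] bounded by blast
  have "Suc K - i = (j - i) + (Suc K - j)" "Suc j = Suc i + (j - i)"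
    using ij by auto
  then have "(f ^^ Suc i \<circ> g ^^ (j - i)) \<circ> g ^^ (Suc K - j) = f ^^ (Suc i + (j - i)) \<circ> g ^^ (Suc K - j)"
    using ij(3) unfolding q_def by (metis funpow_add comp_assoc)
  moreover have "f ^^ Suc i \<circ> g ^^ (j - i) \<in> fixing_entire_maps z\<^sub>0"
    using fixing closed(1)[OF closed(2)[OF f(1)] closed(2)[OF g(1)], of "Suc i" "j - i"] ij(1) by auto
  moreover have "f ^^ (Suc i + (j - i)) \<in> fixing_entire_maps z\<^sub>0"
    using fixing closed(2)[OF f(1), of "Suc i + (j - i)"] by auto
  moreover have "g ^^ (Suc K - j) \<in> fixing_entire_maps z\<^sub>0"
    using fixing closed(2)[OF g(1), of "Suc K - j"] ij(2) by auto
  ultimately have "f ^^ Suc i \<circ> g ^^ (j - i) = f ^^ (Suc i + (j - i))"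
    by (rule fixing_right_cancel)
  then show thesis
    using that[of "j - i" "Suc i"] ij(1) by simp
qed

section \<open>Multiplicatively independent orders\<close>

lemma comp_funpow_commute:
  assumes "u \<circ> v = v \<circ> u"
  shows "v \<circ> u ^^ p = u ^^ p \<circ> v"
proof (induction p)
  case 0
  then show ?case by simp
next
  case (Suc p)
  have "v \<circ> u ^^ Suc p = (v \<circ> u) \<circ> u ^^ p" by (simp add: comp_assoc)
  also have "\<dots> = u \<circ> (v \<circ> u ^^ p)" unfolding assms[symmetric] by (simp add: comp_assoc)
  also have "\<dots> = u \<circ> (u ^^ p \<circ> v)" using arg_cong[OF Suc, of "\<lambda>x. u \<circ> x"] .
  also have "\<dots> = u ^^ Suc p \<circ> v" by (simp add: comp_assoc)
  finally show ?case .
qed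

lemma word_map_commuting:
  assumes "u \<circ> v = v \<circ> u" "u \<noteq> v" "w \<in> lists {u, v}"
  shows "word_map w = u ^^ count (mset w) u \<circ> v ^^ count (mset w) v"
  using assms(3)
proof (induction w)
  case Nil
  have "word_map [] = u ^^ count (mset []) u \<circ> v ^^ count (mset []) v"
    by (simp add: word_map_simps)
  then show ?case .
next
  case (Cons s w)
  define p where "p = count (mset w) u"
  define q where "q = count (mset w) v"
  have IH: "word_map w = u ^^ p \<circ> v ^^ q" and "s \<in> {u, v}"
    using Cons by (auto simp: p_def q_def)
  then consider "s = u" | "s = v" by blast
  then have "word_map (s # w) = u ^^ count (mset (s # w)) u \<circ> v ^^ count (mset (s # w)) v"
  proof cases
    case 1
    then show ?thesis
      using assms(2) by (simp add: word_map_simps IH comp_assoc p_def q_def)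
  next
    case 2
    have "word_map (s # w) = (v \<circ> u ^^ p) \<circ> v ^^ q"
      by (simp add: word_map_simps IH comp_assoc 2)
    also have "\<dots> = u ^^ p \<circ> v ^^ Suc q"
      unfolding comp_funpow_commute[OF assms(1)] by (simp add: comp_assoc)
    finally show ?thesis
      using assms(2) 2 by (simp add: p_def q_def)
  qed
  then show ?case .
qed

text \<open>Commuting letters bring a word into the form \<open>u^p \<circ> v^q\<close>, whose order \<open>U^p V^q\<close> determines \<open>p\<close> and
\<open>q\<close>.\<close>

lemma free_abelian_basis_independent_orders:
  assumes u: "leading_term z\<^sub>0 u U c" "U > 0" and v: "leading_term z\<^sub>0 v V e" "V > 0"
    and comm: "u \<circ> v = v \<circ> u" and "u \<noteq> v"
    and indep: "\<And>p q p' q'. U ^ p * V ^ q = U ^ p' * V ^ q' \<Longrightarrow> p = p' \<and> q = q'"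
  shows "free_abelian_basis {u, v}"
  unfolding free_abelian_basis_def
proof (intro ballI impI iffI)
  note normal = word_map_commuting[OF comm \<open>u \<noteq> v\<close>]
  fix w w' assume w: "w \<in> lists {u, v}" "w' \<in> lists {u, v}"
  show "word_map w = word_map w'" if "mset w = mset w'"
    using normal[OF w(1)] normal[OF w(2)] that by simp
  have order: "\<exists>c. leading_term z\<^sub>0 (word_map x) (U ^ count (mset x) u * V ^ count (mset x) v) c"
    if x: "x \<in> lists {u, v}" for x
  proof -
    obtain b a where "leading_term z\<^sub>0 (u ^^ count (mset x) u) (U ^ count (mset x) u) b"
      "leading_term z\<^sub>0 (v ^^ count (mset x) v) (V ^ count (mset x) v) a"
      using leading_term_funpow[OF u] leading_term_funpow[OF v] by blast
    from leading_term_comp[OF this] v(2) show ?thesis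
      unfolding normal[OF x] by (auto simp: mult.commute)
  qed
  show "mset w = mset w'" if eq: "word_map w = word_map w'"
  proof (rule multiset_eqI)
    fix x
    obtain b a where "leading_term z\<^sub>0 (word_map w) (U ^ count (mset w) u * V ^ count (mset w) v) b"
      "leading_term z\<^sub>0 (word_map w') (U ^ count (mset w') u * V ^ count (mset w') v) a"
      using order[OF w(1)] order[OF w(2)] by blast
    then have "U ^ count (mset w) u * V ^ count (mset w) v = U ^ count (mset w') u * V ^ count (mset w') v"
      using leading_term_unique(1) eq by metis
    note counts = indep[OF this]
    show "count (mset w) x = count (mset w') x"
    proof (cases "x \<in> {u, v}")
      case True
      then show ?thesis using counts by auto
    next
      case False
      then have "x \<notin> set w" "x \<notin> set w'" using w by auto
      then show ?thesis by (metis count_mset_0_iff)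
    qed
  qed
qed

text \<open>Comparing the exponents of \<open>d\<close> would express a positive power of \<open>d\<close> as a power of \<open>m\<close>. The exponent
of the latter is positive because \<open>d \<ge> 2\<close>.\<close>

lemma multiplicatively_independent:
  fixes m d s j p q p' q' :: nat
  assumes "m \<ge> 2" "d \<ge> 2" "j > 0"
    and indep: "\<And>i k. i > 0 \<Longrightarrow> k > 0 \<Longrightarrow> d ^ i \<noteq> m ^ k"
    and eq: "(d * m ^ s) ^ p * (m ^ j) ^ q = (d * m ^ s) ^ p' * (m ^ j) ^ q'"
  shows "p = p' \<and> q = q'"
proof -
  have no: False if less: "p < p'" and eq: "(d * m ^ s) ^ p * (m ^ j) ^ q = (d * m ^ s) ^ p' * (m ^ j) ^ q'"
    for p p' q q'
  proof -
    define r where "r = p' - p"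
    have "r > 0" "p' = p + r" using less by (auto simp: r_def)
    then have "(d * m ^ s) ^ p * m ^ (j * q) = (d * m ^ s) ^ p * (d ^ r * m ^ (s * r + j * q'))"
      using eq by (simp add: power_add power_mult_distrib mult_ac flip: power_mult)
    then have *: "m ^ (j * q) = d ^ r * m ^ (s * r + j * q')"
      using assms(1,2) by simp
    have "d ^ r > 1" using assms(2) \<open>r > 0\<close> one_less_power[of d r] by simp
    have "s * r + j * q' < j * q"
    proof (rule ccontr)
      assume "\<not> s * r + j * q' < j * q"
      then have "m ^ (j * q) \<le> m ^ (s * r + j * q')"
        using assms(1) by (intro power_increasing) auto
      also have "\<dots> < d ^ r * m ^ (s * r + j * q')"
        using \<open>d ^ r > 1\<close> assms(1) by simp
      finally show False using * by simp
    qed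
    then have "m ^ (j * q) = m ^ (j * q - (s * r + j * q')) * m ^ (s * r + j * q')"
      by (simp flip: power_add)
    then have "d ^ r = m ^ (j * q - (s * r + j * q'))"
      using * assms(1) by simp
    then show False
      using indep[of r "j * q - (s * r + j * q')"] \<open>r > 0\<close> \<open>s * r + j * q' < j * q\<close> by simp
  qed
  have "p = p'"
    using no[of p p' q q'] no[of p' p q' q] eq by (metis linorder_neqE_nat)
  moreover from this have "(m ^ j) ^ q = (m ^ j) ^ q'"
    using eq assms(1,2) by simp
  then have "q = q'"
    using assms(1,3) one_less_power[of m j] power_inject_exp[of "m ^ j" q q'] by simp
  ultimately show ?thesis by simp
qed

text \<open>The maps \<open>g^(i + 1) \<circ> f \<circ> g^(K + 1 - i)\<close>, \<open>i \<le> K\<close>, all have order \<open>d m^(K + 2)\<close>, so those for some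
\<open>i < k\<close> coincide. Cancelling \<open>g^(K + 1 - k)\<close> on the right turns this into
\<open>u \<circ> v = v \<circ> u\<close> for \<open>u = g^(i + 1) \<circ> f\<close> and \<open>v = g^(k - i)\<close>.\<close>

lemma independent_orders_free_abelian:
  fixes f g :: "complex \<Rightarrow> complex"
  assumes fixing: "{f, g} \<subseteq> fixing_entire_maps z\<^sub>0"
    and f: "leading_term z\<^sub>0 f d b" "d \<ge> 2" and g: "leading_term z\<^sub>0 g m a" "m \<ge> 2"
    and bounded: "\<And>N. finite (order_class z\<^sub>0 (generated_semigroup {f, g}) N)
             \<and> card (order_class z\<^sub>0 (generated_semigroup {f, g}) N) \<le> K"
    and indep: "\<And>i k. i > 0 \<Longrightarrow> k > 0 \<Longrightarrow> d ^ i \<noteq> m ^ k"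
  shows "\<exists>T \<subseteq> generated_semigroup {f, g}. free_abelian_noncyclic_semigroup T"
proof -
  have gens: "f \<in> generated_semigroup {f, g}" "g \<in> generated_semigroup {f, g}"
    by (auto intro: generated_semigroup.generator)
  have g_pow: "g ^^ n \<in> fixing_entire_maps z\<^sub>0" for n
  proof (induction n)
    case 0
    show ?case using id_fixing by (simp add: id_def)
  next
    case (Suc n)
    have "g \<circ> g ^^ n \<in> fixing_entire_maps z\<^sub>0"
      using fixing Suc by (intro fixing_entire_maps_comp) auto
    then show ?case by (simp add: comp_def)
  qed
  have order: "\<exists>c. leading_term z\<^sub>0 (g ^^ i \<circ> f \<circ> g ^^ k) (m ^ k * (d * m ^ i)) c" for i k
  proof -
    obtain x y where "leading_term z\<^sub>0 (g ^^ i) (m ^ i) x" "leading_term z\<^sub>0 (g ^^ k) (m ^ k) y"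
      using leading_term_funpow[OF g(1)] g(2) by fastforce
    then have "leading_term z\<^sub>0 (g ^^ i \<circ> f \<circ> g ^^ k) (m ^ k * (d * m ^ i))
        (x * b ^ (m ^ i) * y ^ (d * m ^ i))"
      using f g by (intro leading_term_comp) auto
    then show ?thesis by blast
  qed
  define q where "q = (\<lambda>i. g ^^ (Suc i) \<circ> f \<circ> g ^^ (Suc K - i))"
  have "q i \<in> order_class z\<^sub>0 (generated_semigroup {f, g}) (d * m ^ (K + 2))" if "i \<le> K" for i
    unfolding order_class_def mem_Collect_eq
  proof
    show "q i \<in> generated_semigroup {f, g}"
      unfolding q_def using gens that
      by (intro generated_semigroup.comp funpow_in_generated_semigroup) auto
    have "m ^ (Suc K - i) * (d * m ^ Suc i) = d * (m ^ (Suc K - i) * m ^ Suc i)"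
      by simp
    also have "\<dots> = d * m ^ (K + 2)"
      using \<open>i \<le> K\<close> by (subst power_add[symmetric]) simp
    finally have exponents: "m ^ (Suc K - i) * (d * m ^ Suc i) = d * m ^ (K + 2)" .
    show "\<exists>c. leading_term z\<^sub>0 (q i) (d * m ^ (K + 2)) c"
      using order[of "Suc i" "Suc K - i"] unfolding q_def exponents .
  qed
  then obtain i k where ik: "i < k" "k \<le> K" "q i = q k"
    using pigeonhole_sequence[of "order_class z\<^sub>0 (generated_semigroup {f, g}) (d * m ^ (K + 2))" K q]
      bounded by blast
  define u where "u = g ^^ Suc i \<circ> f"
  define v where "v = g ^^ (k - i)"
  have "g ^^ (Suc K - i) = v \<circ> g ^^ (Suc K - k)"
    unfolding v_def funpow_add[symmetric] using ik by simp
  moreover have "g ^^ Suc k = v \<circ> g ^^ Suc i"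
    unfolding v_def funpow_add[symmetric] using ik by simp
  ultimately have swap: "(u \<circ> v) \<circ> g ^^ (Suc K - k) = (v \<circ> u) \<circ> g ^^ (Suc K - k)"
    using ik(3) unfolding q_def u_def by (metis comp_assoc)
  have u_fixing: "u \<in> fixing_entire_maps z\<^sub>0"
    unfolding u_def using fixing fixing_entire_maps_comp[OF g_pow] by blast
  have v_fixing: "v \<in> fixing_entire_maps z\<^sub>0"
    unfolding v_def by (rule g_pow)
  have comm: "u \<circ> v = v \<circ> u"
    by (rule fixing_right_cancel[OF swap fixing_entire_maps_comp[OF u_fixing v_fixing]
          fixing_entire_maps_comp[OF v_fixing u_fixing] g_pow])
  obtain x where x: "leading_term z\<^sub>0 u (d * m ^ Suc i) x"
    using order[of "Suc i" 0] unfolding u_def by auto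
  obtain y where y: "leading_term z\<^sub>0 v (m ^ (k - i)) y"
    using leading_term_funpow[OF g(1)] g(2) unfolding v_def by fastforce
  have orders: "p = p' \<and> q = q'"
    if "(d * m ^ Suc i) ^ p * (m ^ (k - i)) ^ q = (d * m ^ Suc i) ^ p' * (m ^ (k - i)) ^ q'" for p q p' q'
    using multiplicatively_independent[OF g(2) f(2) _ indep that] ik(1) by simp
  have "u \<noteq> v"
  proof
    assume "u = v"
    then have "d * m ^ Suc i = m ^ (k - i)"
      using leading_term_unique(1)[OF x] y by simp
    then show False
      using orders[of 1 0 0 1] by simp
  qed
  then have "free_abelian_basis {u, v}"
    using free_abelian_basis_independent_orders[OF x _ y _ comm _ orders] f(2) g(2) by simp
  then have "free_abelian_noncyclic_semigroup (generated_semigroup {u, v})"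
    unfolding free_abelian_noncyclic_semigroup_def using \<open>u \<noteq> v\<close> by blast
  moreover have "u \<in> generated_semigroup {f, g}" "v \<in> generated_semigroup {f, g}"
    unfolding u_def v_def using ik(1)
    by (intro generated_semigroup.comp funpow_in_generated_semigroup gens; simp)+
  then have "generated_semigroup {u, v} \<subseteq> generated_semigroup {f, g}"
    by (intro generated_semigroup_mono) auto
  ultimately show ?thesis by blast
qed

section \<open>Equality of the sets of preperiodic points\<close>

text \<open>If \<open>f\<close> had order \<open>1\<close>, then \<open>f \<circ> g\<close> and \<open>g\<close> would have the same order, which makes the multiplier \<open>b\<close> of
\<open>f\<close> a root of unity. For \<open>b^j = 1\<close> the maps \<open>f^j \<circ> g\<close> and \<open>g\<close> have the same leading term, hence coincide, and
\<open>f^j\<close> is the identity.\<close>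

lemma order_at_least_two:
  assumes fixing: "{f, g} \<subseteq> fixing_entire_maps z\<^sub>0" and "\<not> inj f"
    and f: "leading_term z\<^sub>0 f d b" "d > 0" and g: "leading_term z\<^sub>0 g m a" "m \<ge> 2"
    and no_free: "\<not> (\<exists>T \<subseteq> generated_semigroup {f, g}. free_noncyclic_semigroup T)"
  shows "d \<ge> 2"
proof (rule ccontr)
  assume "\<not> d \<ge> 2"
  then have "d = 1" using f(2) by simp
  have gens: "f \<in> generated_semigroup {f, g}" "g \<in> generated_semigroup {f, g}"
    by (auto intro: generated_semigroup.generator)
  have pow: "leading_term z\<^sub>0 (f ^^ n) 1 (b ^ n)" for n
  proof (induction n)
    case 0
    have "leading_term z\<^sub>0 (f ^^ 0) 1 (b ^ 0)"
      using leading_term_id[of z\<^sub>0] by simp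
    then show ?case .
  next
    case (Suc n)
    have "leading_term z\<^sub>0 (f ^^ Suc n) 1 (b ^ Suc n)"
      using leading_term_comp[OF f(1) Suc] \<open>d = 1\<close> by simp
    then show ?case .
  qed
  have comp: "leading_term z\<^sub>0 (f ^^ n \<circ> g) m (b ^ n * a)" for n
    using leading_term_comp[OF pow g(1)] g(2) by simp
  obtain j where j: "j > 0" "(b * a) ^ j = a ^ j"
    using no_free_leading_coefficient_ratio[OF fixing no_free _ gens(2) comp[of 1] g]
      generated_semigroup.comp[OF gens] by auto
  then have "b ^ j = 1"
    using g(1) by (simp add: power_mult_distrib leading_term_def)
  have "f ^^ j \<circ> g \<in> generated_semigroup {f, g}"
    using gens j(1) by (intro generated_semigroup.comp funpow_in_generated_semigroup)
  then have "f ^^ j \<circ> g = id \<circ> g"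
    using no_free_leading_coefficient_inj[OF fixing no_free _ gens(2) comp[of j] g] \<open>b ^ j = 1\<close> by simp
  moreover have "f ^^ j \<in> fixing_entire_maps z\<^sub>0"
    using generated_semigroup_subset_fixing[OF fixing] funpow_in_generated_semigroup[OF gens(1) j(1)]
    by blast
  moreover have "g \<in> fixing_entire_maps z\<^sub>0"
    using fixing by simp
  ultimately have "f ^^ j = id"
    using fixing_right_cancel[OF _ _ id_fixing] by blast
  then have "f ^^ (j - 1) \<circ> f = id"
    using j(1) by (metis Suc_pred' funpow_Suc_right)
  then have "inj f"
    by (metis inj_on_id inj_on_imageI2)
  then show False using \<open>\<not> inj f\<close> by blast
qed

lemma preperiodic_points_eq_fixed:
  assumes fixing: "{f, g} \<subseteq> fixing_entire_maps z\<^sub>0" and "\<not> inj f" and "deriv g z\<^sub>0 = 0"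
    and no_free: "\<not> (\<exists>T \<subseteq> generated_semigroup {f, g}. free_noncyclic_semigroup T)"
    and no_free_abelian: "\<not> (\<exists>T \<subseteq> generated_semigroup {f, g}. free_abelian_noncyclic_semigroup T)"
  shows "preperiodic_points f = preperiodic_points g"
proof -
  obtain d b where f: "d > 0" "leading_term z\<^sub>0 f d b"
    using leading_term_exists fixing by blast
  obtain m a where g: "leading_term z\<^sub>0 g m a"
    using leading_term_exists fixing by blast
  have "m \<ge> 2"
    using superattracting_order[OF _ g assms(3)] fixing by blast
  have "d \<ge> 2"
    using order_at_least_two[OF fixing assms(2) f(2,1) g \<open>m \<ge> 2\<close> no_free] .
  obtain K where bounded: "\<And>N. finite (order_class z\<^sub>0 (generated_semigroup {f, g}) N)
      \<and> card (order_class z\<^sub>0 (generated_semigroup {f, g}) N) \<le> K"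
    using no_free_order_class_bounded[OF fixing f(2) \<open>d \<ge> 2\<close> g \<open>m \<ge> 2\<close> no_free] by blast
  obtain i k where ik: "i > 0" "k > 0" "d ^ i = m ^ k"
    using independent_orders_free_abelian[OF fixing f(2) \<open>d \<ge> 2\<close> g \<open>m \<ge> 2\<close> bounded]
      no_free_abelian by blast
  define M where "M = d ^ i"
  have M: "M = m ^ k" "M > 0"
    using ik \<open>d \<ge> 2\<close> \<open>m \<ge> 2\<close> by (auto simp: M_def)
  have gens: "f ^^ i \<in> generated_semigroup {f, g}" "g ^^ k \<in> generated_semigroup {f, g}"
    using ik by (intro funpow_in_generated_semigroup generated_semigroup.generator; simp)+
  obtain b' where f': "leading_term z\<^sub>0 (f ^^ i) M b'"
    using leading_term_funpow[OF f(2,1)] unfolding M_def by blast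
  obtain a' where g': "leading_term z\<^sub>0 (g ^^ k) M a'"
    using leading_term_funpow[OF g] \<open>m \<ge> 2\<close> unfolding M(1) by fastforce
  note relation = same_order_relation[OF fixing bounded]
  obtain s t where "s > 0" "(f ^^ i) ^^ (t + s) = (f ^^ i) ^^ t \<circ> (g ^^ k) ^^ s"
    using relation[OF gens(1) f' gens(2) g' M(2)] by metis
  then have "preperiodic_points (g ^^ k) \<subseteq> preperiodic_points (f ^^ i)"
    by (intro preperiodic_points_subset)
  moreover obtain s t where "s > 0" "(g ^^ k) ^^ (t + s) = (g ^^ k) ^^ t \<circ> (f ^^ i) ^^ s"
    using relation[OF gens(2) g' gens(1) f' M(2)] by metis
  then have "preperiodic_points (f ^^ i) \<subseteq> preperiodic_points (g ^^ k)"
    by (intro preperiodic_points_subset)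
  ultimately show ?thesis
    using preperiodic_points_funpow ik(1,2) by (metis subset_antisym)
qed

lemma entire_nonconstant_funpow:
  fixes f :: "complex \<Rightarrow> complex"
  assumes "f holomorphic_on UNIV" "\<not> f constant_on UNIV"
  shows "f ^^ n holomorphic_on UNIV \<and> \<not> (f ^^ n) constant_on UNIV"
proof (induction n)
  case 0
  show ?case using id_fixing[of 0] unfolding fixing_entire_maps_def by (simp add: id_def)
next
  case (Suc n)
  have hol: "f ^^ Suc n holomorphic_on UNIV"
    unfolding funpow_Suc_right using assms(1) Suc
    by (intro holomorphic_on_compose) (auto intro: holomorphic_on_subset)
  moreover have "\<not> (f ^^ Suc n) constant_on UNIV"
  proof
    assume "(f ^^ Suc n) constant_on UNIV"
    then obtain c where "f ^^ n \<circ> f = (\<lambda>_. c) \<circ> f"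
      unfolding funpow_Suc_right by (auto simp: constant_on_def fun_eq_iff)
    then have "f ^^ n = (\<lambda>_. c)"
      using assms Suc by (intro entire_right_cancel[of "f ^^ n" _ f]) auto
    then show False using Suc by (auto simp: constant_on_def)
  qed
  ultimately show ?case by blast
qed

theorem theorem8:
  fixes f g :: "complex \<Rightarrow> complex" and z\<^sub>0 :: complex
  assumes "f holomorphic_on UNIV" and "g holomorphic_on UNIV"
    and "\<not> f constant_on UNIV" and "\<not> g constant_on UNIV"
    and "\<not> inj f" and "\<not> inj g"
    and "periodic_point f z\<^sub>0" and "periodic_point g z\<^sub>0"
    and "superattracting g z\<^sub>0"
    and "\<not> (\<exists>T \<subseteq> generated_semigroup {f, g}. free_noncyclic_semigroup T)"
    and "\<not> (\<exists>T \<subseteq> generated_semigroup {f, g}. free_abelian_noncyclic_semigroup T)"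
  shows "preperiodic_points f = preperiodic_points g"
proof -
  obtain k where k: "k > 0" "(f ^^ k) z\<^sub>0 = z\<^sub>0"
    using assms(7) by (auto simp: periodic_point_def has_period_def)
  obtain l where l: "l > 0" "(g ^^ l) z\<^sub>0 = z\<^sub>0" "deriv (g ^^ l) z\<^sub>0 = 0"
    using assms(9) by (auto simp: superattracting_def has_period_def)
  have "{f ^^ k, g ^^ l} \<subseteq> fixing_entire_maps z\<^sub>0"
    using entire_nonconstant_funpow[OF assms(1,3)] entire_nonconstant_funpow[OF assms(2,4)] k l
    unfolding fixing_entire_maps_def by blast
  moreover have "\<not> inj (f ^^ k)"
  proof
    assume "inj (f ^^ k)"
    moreover have "f ^^ k = f ^^ (k - 1) \<circ> f"
      using k(1) by (metis Suc_pred' funpow_Suc_right)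
    ultimately have "inj f" by (metis inj_on_imageI2)
    then show False using assms(5) by blast
  qed
  moreover have sub: "generated_semigroup {f ^^ k, g ^^ l} \<subseteq> generated_semigroup {f, g}"
  proof (rule generated_semigroup_mono)
    show "{f ^^ k, g ^^ l} \<subseteq> generated_semigroup {f, g}"
      using funpow_in_generated_semigroup[of f "{f, g}" k] funpow_in_generated_semigroup[of g "{f, g}" l]
        k(1) l(1) generated_semigroup.generator[of _ "{f, g}"] by simp
  qed
  ultimately have "preperiodic_points (f ^^ k) = preperiodic_points (g ^^ l)"
    using assms(10,11) l(3) by (intro preperiodic_points_eq_fixed[of _ _ z\<^sub>0]) blast+
  then show ?thesis
    using preperiodic_points_funpow k(1) l(1) by metis
qed

end
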